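(* The $D$-functions $\mathcal{D}^{\,j}_{m',m}$ ($j\in\{0,\frac12,1,\dots\}$, $m',m\in\{-j,\dots,j\}$) for the Jordanian quantum group $GL_h(2)$ are given by $$\mathcal{D}^{\,j}_{m',m}=\{(j+m')!(j-m')!(j+m)!(j-m)!\}^{1/2}\sum_{K,L,M,N}\frac{X_K\,v^L\,U_{K,L,M}\,Y_{K,L,M,N}}{K!\,M!\,L!\,N!},$$ where (ordered products, factors written from left to right in order of increasing $i$) $$X_K=x(x+hv)\cdots(x+h(K-1)v)=\prod_{i=0}^{K-1}(x+h\,i\,v),$$ $$U_{K,L,M}=\prod_{i=0}^{M-1}\big(u-h(K+L-i)x+h(K-L+i)y-h^2(K^2-(L-i)^2)v\big),$$ $$Y_{K,L,M,N}=\prod_{i=0}^{N-1}\big(y-h(K+L-M-i)v\big).$$ They have another expression, which is $$\mathcal{D}^{\,j}_{m',m}=\{(j+m')!(j-m')!(j+m)!(j-m)!\}^{1/2}\sum_{K,L,M,N}\frac{U_M\,X_{K,M}\,Y_{K,M,N}\,v^L}{K!\,M!\,L!\,N!},$$ where $$U_M=\prod_{i=0}^{M-1}\big(u+h\,i\,(x+y)+h^2i^2v\big),\quad X_{K,M}=\prod_{i=0}^{K-1}\big(x+h(M+i)v\big),\quad Y_{K,M,N}=\prod_{i=0}^{N-1}\big(y-h(K-M-i)v\big).$$ In both formulas the sum runs over nonnegative integers $K,L,M,N$ with $K+L=j+m$, $M+N=j-m$, $K+M=j+m'$, $L+N=j-m'$. That is, the two expressions define the same elements of $GL_h(2)$,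 and for each $j$ these elements satisfy $$\Delta(\mathcal{D}^{\,j}_{m',m})=\sum_{k=-j}^{j}\mathcal{D}^{\,j}_{m',k}\otimes\mathcal{D}^{\,j}_{k,m},\qquad\epsilon(\mathcal{D}^{\,j}_{m',m})=\delta_{m',m}.$$
   Context: $GL_h(2)$: the Hopf algebra generated by $x,y,u,v$ with relations $[v,x]=hv^2$, $[u,x]=h(D-x^2)$, $[v,y]=hv^2$, $[u,y]=h(D-y^2)$, $[x,y]=h(xv-yv)$, $[v,u]=h(xv+vy)$, where $D=xy-uv-hxv$ is the quantum determinant, generating the center; $h$ is the deformation parameter. The coproduct and counit are those of the matrix $\begin{pmatrix} x & u \\ v & y \end{pmatrix}$: $\Delta(x)=x\otimes x+u\otimes v$, $\Delta(u)=x\otimes u+u\otimes y$, $\Delta(v)=v\otimes x+y\otimes v$, $\Delta(y)=v\otimes u+y\otimes y$, $\epsilon(x)=\epsilon(y)=1$, $\epsilon(u)=\epsilon(v)=0$. $D$-functions of $GL_h(2)$ for a finite dimensional right comodule with basis $e_i$ and coaction $\rho(e_i)=\sum_je_j\otimes\mathcal{D}_{ji}$ are the elements $\mathcal{D}_{ij}\in GL_h(2)$; equivalently, they are elements satisfying $\Delta(\mathcal{D}_{ij})=\sum_k\mathcal{D}_{ik}\otimes\mathcal{D}_{kj}$ and $\epsilon(\mathcal{D}_{ij})=\delta_{ij}$. Here they are considered for the spin-$j$ irreducible representations, of dimension $2j+1$. Empty products equal $1$. *)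

theory Defs
  imports Complex_Main "HOL-Algebra.QuotRing" "HOL-Algebra.Module" "HOL-Library.Poly_Mapping"
begin

section \<open>Complex associative algebras\<close>

text \<open>
  A (not necessarily commutative) complex algebra is given by a record of type
  \<open>(complex, 'a) module\<close>, i.e. a HOL-Algebra ring record extended by a scalar multiplication.
\<close>

definition complex_algebra :: "(complex, complex) module" where
  "complex_algebra =
     \<lparr>carrier = UNIV, mult = (*), one = 1, zero = 0, add = (+), smult = (*)\<rparr>"

definition monoid_algebra ::
    "('a, 'm) monoid_scheme \<Rightarrow> (complex, 'a \<Rightarrow>\<^sub>0 complex) module" where
  "monoid_algebra G =
     \<lparr>carrier = {f. Poly_Mapping.keys f \<subseteq> carrier G},
      mult = (\<lambda>f g. \<Sum>a\<in>Poly_Mapping.keys f. \<Sum>b\<in>Poly_Mapping.keys g.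
                Poly_Mapping.single (a \<otimes>\<^bsub>G\<^esub> b) (Poly_Mapping.lookup f a * Poly_Mapping.lookup g b)),
      one = Poly_Mapping.single \<one>\<^bsub>G\<^esub> 1,
      zero = 0,
      add = (+),
      smult = (\<lambda>c. Poly_Mapping.map ((*) c))\<rparr>"

definition quotient_algebra ::
    "(complex, 'a) module \<Rightarrow> 'a set \<Rightarrow> (complex, 'a set) module" where
  "quotient_algebra A I =
     ring.extend (A Quot I) (module.fields (\<lambda>c C. \<Union>a\<in>C. I +>\<^bsub>A\<^esub> (c \<odot>\<^bsub>A\<^esub> a)))"

text \<open>
  For a set \<open>R\<close> of relations, a pair \<open>(a, b) \<in> R\<close> standing for the relation \<open>a = b\<close>, the two-sided
  ideal generated by all \<open>a - b\<close>. In a monoid algebra the ring ideals are the algebra ideals,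
  because the scalars are the multiples of the unit element.
\<close>

definition relation_ideal :: "(complex, 'a) module \<Rightarrow> ('a \<times> 'a) set \<Rightarrow> 'a set" where
  "relation_ideal A R = Idl\<^bsub>A\<^esub> {a \<ominus>\<^bsub>A\<^esub> b | a b. (a, b) \<in> R}"

subsection \<open>Free algebras\<close>

definition word_monoid :: "'g list monoid" where
  "word_monoid = \<lparr>carrier = UNIV, mult = (@), one = []\<rparr>"

definition free_algebra :: "(complex, 'g list \<Rightarrow>\<^sub>0 complex) module" where
  "free_algebra = monoid_algebra word_monoid"

definition free_gen :: "'g \<Rightarrow> 'g list \<Rightarrow>\<^sub>0 complex" where
  "free_gen s = Poly_Mapping.single [s] 1"

text \<open>The algebra homomorphism from the free algebra to \<open>A\<close> that sends each generator \<open>s\<close> to \<open>g s\<close>.\<close>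

definition free_lift ::
    "(complex, 'a) module \<Rightarrow> ('g \<Rightarrow> 'a) \<Rightarrow> ('g list \<Rightarrow>\<^sub>0 complex) \<Rightarrow> 'a" where
  "free_lift A g f =
     (\<Oplus>\<^bsub>A\<^esub>w\<in>Poly_Mapping.keys f. Poly_Mapping.lookup f w \<odot>\<^bsub>A\<^esub> foldr (\<lambda>s p. g s \<otimes>\<^bsub>A\<^esub> p) w \<one>\<^bsub>A\<^esub>)"

text \<open>Meaningful only for a map \<open>\<phi>\<close> that is constant on the cosets.\<close>

definition quotient_lift :: "('a \<Rightarrow> 'b) \<Rightarrow> 'a set \<Rightarrow> 'b" where
  "quotient_lift \<phi> C = the_elem (\<phi> ` C)"

subsection \<open>Tensor products\<close>

text \<open>
  The vector space freely generated by \<open>carrier A \<times> carrier B\<close>, modulo bilinearity. As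
  \<open>carrier A \<times> carrier B\<close> is a monoid under \<open>(a, b)(a', b') = (aa', bb')\<close>, this free vector space
  is a monoid algebra. Multiplying both sides of a relation below by a pair, from the left or from
  the right, gives a relation of the same kind, so that the generated ideal is just a linear span:
  the quotient is the usual tensor product of vector spaces, with multiplication
  \<open>(a \<otimes> b)(a' \<otimes> b') = aa' \<otimes> bb'\<close>.
\<close>

definition bilinearity ::
    "(complex, 'a) module \<Rightarrow> (complex, 'b) module
      \<Rightarrow> (('a \<times> 'b \<Rightarrow>\<^sub>0 complex) \<times> ('a \<times> 'b \<Rightarrow>\<^sub>0 complex)) set" where
  "bilinearity A B =
     {(Poly_Mapping.single (a \<oplus>\<^bsub>A\<^esub> a', b) 1,
       Poly_Mapping.single (a, b) 1 + Poly_Mapping.single (a', b) 1) | a a' b.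
        a \<in> carrier A \<and> a' \<in> carrier A \<and> b \<in> carrier B} \<union>
     {(Poly_Mapping.single (a, b \<oplus>\<^bsub>B\<^esub> b') 1,
       Poly_Mapping.single (a, b) 1 + Poly_Mapping.single (a, b') 1) | a b b'.
        a \<in> carrier A \<and> b \<in> carrier B \<and> b' \<in> carrier B} \<union>
     {(Poly_Mapping.single (c \<odot>\<^bsub>A\<^esub> a, b) 1, Poly_Mapping.single (a, b) c) | c a b.
        a \<in> carrier A \<and> b \<in> carrier B} \<union>
     {(Poly_Mapping.single (a, c \<odot>\<^bsub>B\<^esub> b) 1, Poly_Mapping.single (a, b) c) | c a b.
        a \<in> carrier A \<and> b \<in> carrier B}"

definition tensor_ideal ::
    "(complex, 'a) module \<Rightarrow> (complex, 'b) module \<Rightarrow> ('a \<times> 'b \<Rightarrow>\<^sub>0 complex) set" where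
  "tensor_ideal A B = relation_ideal (monoid_algebra (A \<times>\<times> B)) (bilinearity A B)"

definition tensor_algebra ::
    "(complex, 'a) module \<Rightarrow> (complex, 'b) module
      \<Rightarrow> (complex, ('a \<times> 'b \<Rightarrow>\<^sub>0 complex) set) module" where
  "tensor_algebra A B = quotient_algebra (monoid_algebra (A \<times>\<times> B)) (tensor_ideal A B)"

definition pure_tensor ::
    "(complex, 'a) module \<Rightarrow> (complex, 'b) module \<Rightarrow> 'a \<Rightarrow> 'b
      \<Rightarrow> ('a \<times> 'b \<Rightarrow>\<^sub>0 complex) set" where
  "pure_tensor A B a b =
     tensor_ideal A B +>\<^bsub>monoid_algebra (A \<times>\<times> B)\<^esub> Poly_Mapping.single (a, b) 1"


section \<open>The Jordanian quantum group\<close>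

text \<open>
  A two-sided inverse \<open>D\<^sup>-\<^sup>1\<close> of the quantum determinant is adjoined to the algebra generated by
  \<open>x, y, u, v\<close>: \<open>D\<close> is group-like, so it has to be invertible for an antipode to exist.
\<close>

datatype gl_gen = Gen_x | Gen_y | Gen_u | Gen_v | Gen_Dinv

definition commutator :: "(complex, 'a) module \<Rightarrow> 'a \<Rightarrow> 'a \<Rightarrow> 'a" where
  "commutator A a b = a \<otimes>\<^bsub>A\<^esub> b \<ominus>\<^bsub>A\<^esub> b \<otimes>\<^bsub>A\<^esub> a"

definition qdet :: "(complex, 'a) module \<Rightarrow> complex \<Rightarrow> 'a \<Rightarrow> 'a \<Rightarrow> 'a \<Rightarrow> 'a \<Rightarrow> 'a" where
  "qdet A h x y u v = x \<otimes>\<^bsub>A\<^esub> y \<ominus>\<^bsub>A\<^esub> u \<otimes>\<^bsub>A\<^esub> v \<ominus>\<^bsub>A\<^esub> h \<odot>\<^bsub>A\<^esub> (x \<otimes>\<^bsub>A\<^esub> v)"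

definition gl_relations ::
    "complex \<Rightarrow> ((gl_gen list \<Rightarrow>\<^sub>0 complex) \<times> (gl_gen list \<Rightarrow>\<^sub>0 complex)) set" where
  "gl_relations h =
     (let F = free_algebra;
          x = free_gen Gen_x; y = free_gen Gen_y; u = free_gen Gen_u; v = free_gen Gen_v;
          t = free_gen Gen_Dinv; D = qdet F h x y u v
      in {(commutator F v x, h \<odot>\<^bsub>F\<^esub> (v \<otimes>\<^bsub>F\<^esub> v)),
          (commutator F u x, h \<odot>\<^bsub>F\<^esub> (D \<ominus>\<^bsub>F\<^esub> x \<otimes>\<^bsub>F\<^esub> x)),
          (commutator F v y, h \<odot>\<^bsub>F\<^esub> (v \<otimes>\<^bsub>F\<^esub> v)),
          (commutator F u y, h \<odot>\<^bsub>F\<^esub> (D \<ominus>\<^bsub>F\<^esub> y \<otimes>\<^bsub>F\<^esub> y)),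
          (commutator F x y, h \<odot>\<^bsub>F\<^esub> (x \<otimes>\<^bsub>F\<^esub> v \<ominus>\<^bsub>F\<^esub> y \<otimes>\<^bsub>F\<^esub> v)),
          (commutator F v u, h \<odot>\<^bsub>F\<^esub> (x \<otimes>\<^bsub>F\<^esub> v \<oplus>\<^bsub>F\<^esub> v \<otimes>\<^bsub>F\<^esub> y)),
          (D \<otimes>\<^bsub>F\<^esub> t, \<one>\<^bsub>F\<^esub>),
          (t \<otimes>\<^bsub>F\<^esub> D, \<one>\<^bsub>F\<^esub>)})"

type_synonym gl_elem = "(gl_gen list \<Rightarrow>\<^sub>0 complex) set"

definition gl_ideal :: "complex \<Rightarrow> (gl_gen list \<Rightarrow>\<^sub>0 complex) set" where
  "gl_ideal h = relation_ideal free_algebra (gl_relations h)"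

definition GL :: "complex \<Rightarrow> (complex, gl_elem) module" where
  "GL h = quotient_algebra free_algebra (gl_ideal h)"

definition gl_gen_elem :: "complex \<Rightarrow> gl_gen \<Rightarrow> gl_elem" where
  "gl_gen_elem h s = gl_ideal h +>\<^bsub>free_algebra\<^esub> free_gen s"

abbreviation gl_x :: "complex \<Rightarrow> gl_elem" where "gl_x h \<equiv> gl_gen_elem h Gen_x"
abbreviation gl_y :: "complex \<Rightarrow> gl_elem" where "gl_y h \<equiv> gl_gen_elem h Gen_y"
abbreviation gl_u :: "complex \<Rightarrow> gl_elem" where "gl_u h \<equiv> gl_gen_elem h Gen_u"
abbreviation gl_v :: "complex \<Rightarrow> gl_elem" where "gl_v h \<equiv> gl_gen_elem h Gen_v"
abbreviation gl_Dinv :: "complex \<Rightarrow> gl_elem" where "gl_Dinv h \<equiv> gl_gen_elem h Gen_Dinv"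

abbreviation GL2 :: "complex \<Rightarrow> (complex, (gl_elem \<times> gl_elem \<Rightarrow>\<^sub>0 complex) set) module" where
  "GL2 h \<equiv> tensor_algebra (GL h) (GL h)"

abbreviation gl_tensor ::
    "complex \<Rightarrow> gl_elem \<Rightarrow> gl_elem \<Rightarrow> (gl_elem \<times> gl_elem \<Rightarrow>\<^sub>0 complex) set" where
  "gl_tensor h \<equiv> pure_tensor (GL h) (GL h)"

fun comult_gen :: "complex \<Rightarrow> gl_gen \<Rightarrow> (gl_elem \<times> gl_elem \<Rightarrow>\<^sub>0 complex) set" where
  "comult_gen h Gen_x =
     gl_tensor h (gl_x h) (gl_x h) \<oplus>\<^bsub>GL2 h\<^esub> gl_tensor h (gl_u h) (gl_v h)"
| "comult_gen h Gen_u =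
     gl_tensor h (gl_x h) (gl_u h) \<oplus>\<^bsub>GL2 h\<^esub> gl_tensor h (gl_u h) (gl_y h)"
| "comult_gen h Gen_v =
     gl_tensor h (gl_v h) (gl_x h) \<oplus>\<^bsub>GL2 h\<^esub> gl_tensor h (gl_y h) (gl_v h)"
| "comult_gen h Gen_y =
     gl_tensor h (gl_v h) (gl_u h) \<oplus>\<^bsub>GL2 h\<^esub> gl_tensor h (gl_y h) (gl_y h)"
| "comult_gen h Gen_Dinv = gl_tensor h (gl_Dinv h) (gl_Dinv h)"

fun counit_gen :: "gl_gen \<Rightarrow> complex" where
  "counit_gen Gen_x = 1"
| "counit_gen Gen_u = 0"
| "counit_gen Gen_v = 0"
| "counit_gen Gen_y = 1"
| "counit_gen Gen_Dinv = 1"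

definition comult :: "complex \<Rightarrow> gl_elem \<Rightarrow> (gl_elem \<times> gl_elem \<Rightarrow>\<^sub>0 complex) set" where
  "comult h = quotient_lift (free_lift (GL2 h) (comult_gen h))"

definition counit :: "gl_elem \<Rightarrow> complex" where
  "counit = quotient_lift (free_lift complex_algebra counit_gen)"


definition ordered_prod :: "(complex, 'a) module \<Rightarrow> (nat \<Rightarrow> 'a) \<Rightarrow> nat \<Rightarrow> 'a" where
  "ordered_prod A f n = foldr (\<lambda>i p. f i \<otimes>\<^bsub>A\<^esub> p) [0..<n] \<one>\<^bsub>A\<^esub>"

text \<open>For a half-integer \<open>j \<ge> 0\<close> this is \<open>{-j, -j + 1, \<dots>, j}\<close>.\<close>

definition weights :: "real \<Rightarrow> real set" where
  "weights j = {m. j + m \<in> \<nat> \<and> j - m \<in> \<nat>}"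

definition summation_range :: "real \<Rightarrow> real \<Rightarrow> real \<Rightarrow> (nat \<times> nat \<times> nat \<times> nat) set" where
  "summation_range j m' m =
     {(K, L, M, N). real (K + L) = j + m \<and> real (M + N) = j - m \<and>
                    real (K + M) = j + m' \<and> real (L + N) = j - m'}"

definition prefactor :: "real \<Rightarrow> real \<Rightarrow> real \<Rightarrow> complex" where
  "prefactor j m' m =
     complex_of_real (sqrt (fact (nat \<lfloor>j + m'\<rfloor>) * fact (nat \<lfloor>j - m'\<rfloor>) *
                            fact (nat \<lfloor>j + m\<rfloor>) * fact (nat \<lfloor>j - m\<rfloor>)))"

definition X1 :: "complex \<Rightarrow> nat \<Rightarrow> gl_elem" where
  "X1 h K = ordered_prod (GL h) (\<lambda>i. gl_x h \<oplus>\<^bsub>GL h\<^esub> (h * of_nat i) \<odot>\<^bsub>GL h\<^esub> gl_v h) K"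

definition U1 :: "complex \<Rightarrow> nat \<Rightarrow> nat \<Rightarrow> nat \<Rightarrow> gl_elem" where
  "U1 h K L M = ordered_prod (GL h)
     (\<lambda>i. gl_u h
          \<ominus>\<^bsub>GL h\<^esub> (h * (of_nat K + of_nat L - of_nat i)) \<odot>\<^bsub>GL h\<^esub> gl_x h
          \<oplus>\<^bsub>GL h\<^esub> (h * (of_nat K - of_nat L + of_nat i)) \<odot>\<^bsub>GL h\<^esub> gl_y h
          \<ominus>\<^bsub>GL h\<^esub> (h^2 * (of_nat K ^ 2 - (of_nat L - of_nat i) ^ 2)) \<odot>\<^bsub>GL h\<^esub> gl_v h) M"

definition Y1 :: "complex \<Rightarrow> nat \<Rightarrow> nat \<Rightarrow> nat \<Rightarrow> nat \<Rightarrow> gl_elem" where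
  "Y1 h K L M N = ordered_prod (GL h)
     (\<lambda>i. gl_y h
          \<ominus>\<^bsub>GL h\<^esub> (h * (of_nat K + of_nat L - of_nat M - of_nat i)) \<odot>\<^bsub>GL h\<^esub> gl_v h) N"

definition D_fun1 :: "complex \<Rightarrow> real \<Rightarrow> real \<Rightarrow> real \<Rightarrow> gl_elem" where
  "D_fun1 h j m' m =
     prefactor j m' m \<odot>\<^bsub>GL h\<^esub>
       (\<Oplus>\<^bsub>GL h\<^esub>p \<in> summation_range j m' m. case p of (K, L, M, N) \<Rightarrow>
          (1 / (fact K * fact M * fact L * fact N)) \<odot>\<^bsub>GL h\<^esub>
            (X1 h K \<otimes>\<^bsub>GL h\<^esub> gl_v h [^]\<^bsub>GL h\<^esub> L \<otimes>\<^bsub>GL h\<^esub> U1 h K L M \<otimes>\<^bsub>GL h\<^esub> Y1 h K L M N))"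

definition U2 :: "complex \<Rightarrow> nat \<Rightarrow> gl_elem" where
  "U2 h M = ordered_prod (GL h)
     (\<lambda>i. gl_u h
          \<oplus>\<^bsub>GL h\<^esub> (h * of_nat i) \<odot>\<^bsub>GL h\<^esub> (gl_x h \<oplus>\<^bsub>GL h\<^esub> gl_y h)
          \<oplus>\<^bsub>GL h\<^esub> (h^2 * of_nat i ^ 2) \<odot>\<^bsub>GL h\<^esub> gl_v h) M"

definition X2 :: "complex \<Rightarrow> nat \<Rightarrow> nat \<Rightarrow> gl_elem" where
  "X2 h K M = ordered_prod (GL h)
     (\<lambda>i. gl_x h \<oplus>\<^bsub>GL h\<^esub> (h * (of_nat M + of_nat i)) \<odot>\<^bsub>GL h\<^esub> gl_v h) K"

definition Y2 :: "complex \<Rightarrow> nat \<Rightarrow> nat \<Rightarrow> nat \<Rightarrow> gl_elem" where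
  "Y2 h K M N = ordered_prod (GL h)
     (\<lambda>i. gl_y h
          \<ominus>\<^bsub>GL h\<^esub> (h * (of_nat K - of_nat M - of_nat i)) \<odot>\<^bsub>GL h\<^esub> gl_v h) N"

definition D_fun2 :: "complex \<Rightarrow> real \<Rightarrow> real \<Rightarrow> real \<Rightarrow> gl_elem" where
  "D_fun2 h j m' m =
     prefactor j m' m \<odot>\<^bsub>GL h\<^esub>
       (\<Oplus>\<^bsub>GL h\<^esub>p \<in> summation_range j m' m. case p of (K, L, M, N) \<Rightarrow>
          (1 / (fact K * fact M * fact L * fact N)) \<odot>\<^bsub>GL h\<^esub>
            (U2 h M \<otimes>\<^bsub>GL h\<^esub> X2 h K M \<otimes>\<^bsub>GL h\<^esub> Y2 h K M N \<otimes>\<^bsub>GL h\<^esub> gl_v h [^]\<^bsub>GL h\<^esub> L))"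

end

theory Submission
  imports Defs
begin

text \<open>
  Write \<open>X(a) = x + a v\<close>, \<open>Y(b) = y - b v\<close> and \<open>W(a, b) = u - b x + a y - a b v\<close> for complex
  \<open>a, b\<close>. Every factor in the two formulas is \<open>v\<close> or one of these three, the last one because
  \<open>h\<^sup>2 (K\<^sup>2 - (L - i)\<^sup>2)\<close> is the product of \<open>h (K - L + i)\<close> and \<open>h (K + L - i)\<close>. The quadratic
  relations say that factors can be moved past each other at the price of shifting the parameters
  by \<open>h\<close>; for example \<open>v X(a) = X(a + h) v\<close> and \<open>W(a, b) X(a + h) = X(a) W(a + h, b + h)\<close>.

  \<^bold>\<open>The two formulas agree term by term.\<close> Each product is built up from \<open>1\<close> by multiplications from
  the right, and for both kinds of product the same right factor raises the same exponent if the
  exponents are raised in the order \<open>M\<close>, \<open>K\<close>, \<open>N\<close>, \<open>L\<close> (\<open>term1_eq_term2\<close>). Playing one form against the other then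
  shows that the product with exponents \<open>(K, L, M, N)\<close>, of degree \<open>n\<close>, row \<open>a = K + M\<close> and column
  \<open>b = K + L\<close>, has \<open>K\<close>, \<open>L\<close>, \<open>M\<close> or \<open>N\<close> raised by one when it is multiplied on the right by
  \<open>X(\<alpha>)\<close>, \<open>v\<close>, \<open>W(\<alpha>, \<beta>)\<close> or \<open>Y(\<beta>)\<close>, where \<open>\<alpha> = h (2 a - n)\<close> and \<open>\<beta> = h (2 b - n)\<close> depend on the row
  and the column only. Summing with the weights \<open>1 / (K! L! M! N!)\<close>, the unnormalised matrix
  elements \<open>f\<^sub>n\<close> satisfy
  \<open>(n + 1 - a) f\<^sub>n\<^sub>+\<^sub>1(a, b) = f\<^sub>n(a, b - 1) v + f\<^sub>n(a, b) Y(\<beta>)\<close> and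
  \<open>(a + 1) f\<^sub>n\<^sub>+\<^sub>1(a + 1, b) = f\<^sub>n(a, b - 1) X(\<alpha>) + f\<^sub>n(a, b) W(\<alpha>, \<beta>)\<close>
  (\<open>matrix_elem_lower\<close>, \<open>matrix_elem_raise\<close>).

  \<^bold>\<open>Coproduct.\<close> These are the recurrences that describe how the tensor product of the
  \<open>(n + 1)\<close>-dimensional corepresentation with the defining one maps onto the next corepresentation.
  Applying \<open>\<Delta>\<close> to a recurrence and inserting \<open>\<Delta> f\<^sub>n(a, b) = \<Sum>\<^sub>k k! (n - k)! f\<^sub>n(a, k) \<otimes> f\<^sub>n(k, b)\<close>, the
  second tensor factors recombine by both recurrences, and the first ones by the recurrence that was
  started from; this proves the formula for \<open>n + 1\<close> (\<open>tensor_step\<close>). The square roots in the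
  normalisation absorb \<open>k! (n - k)!\<close>. For the counit, \<open>W(0, 0) = u\<close> and \<open>v\<close> are killed, so only the
  term with \<open>L = M = 0\<close> survives.

  \<^bold>\<open>Realisation.\<close> The quantum group and its tensor square are quotients of monoid algebras, given as
  records with a carrier, and the coproduct and the counit descend to the quotient only because the
  relations are preserved. All computations, including that check, are carried out in a type class
  of complex algebras, where rewriting is convenient. They are transported by a type whose elements
  choose one element from every algebra record at the same time: it is an instance of the class, and
  every algebra record is a homomorphic image of it.
\<close>

section \<open>Complex algebras as a type class\<close>

text \<open>
  The class extends \<open>ring\<close> and \<open>monoid_mult\<close> instead of \<open>ring_1\<close> in order to admit the zero ring: its main
  instance below is polymorphic and trivial for some types.
\<close>

class complex_alg = ring + monoid_mult +
  fixes scl :: "complex \<Rightarrow> 'a \<Rightarrow> 'a" (infixr "*\<^sub>C" 75)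
  assumes scl_add_right: "c *\<^sub>C (a + b) = c *\<^sub>C a + c *\<^sub>C b"
    and scl_add_left: "(c + d) *\<^sub>C a = c *\<^sub>C a + d *\<^sub>C a"
    and scl_scl: "c *\<^sub>C d *\<^sub>C a = (c * d) *\<^sub>C a"
    and scl_one: "1 *\<^sub>C a = a"
    and scl_mult_left: "(c *\<^sub>C a) * b = c *\<^sub>C (a * b)"
    and mult_scl_right: "a * (c *\<^sub>C b) = c *\<^sub>C (a * b)"

interpretation complex_alg: Modules.module "scl :: complex \<Rightarrow> 'a \<Rightarrow> 'a::complex_alg"
  by unfold_locales (simp_all add: scl_add_right scl_add_left scl_scl scl_one)

lemmas scl_expand = scl_mult_left mult_scl_right complex_alg.scale_left_distrib
  complex_alg.scale_right_distrib complex_alg.scale_left_diff_distrib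
  complex_alg.scale_right_diff_distrib complex_alg.scale_minus_left complex_alg.scale_minus_right

abbreviation oprod :: "(nat \<Rightarrow> 'a::monoid_mult) \<Rightarrow> nat \<Rightarrow> 'a" where
  "oprod F n \<equiv> prod_list (map F [0..<n])"

text \<open>
  The element that is moved from the right end to the left end may change on its way: \<open>Z i\<close> is what
  it has become once only the first \<open>i\<close> factors are left of it.
\<close>

lemma oprod_exchange:
  assumes "\<And>i. i < n \<Longrightarrow> F i * Z (Suc i) = Z i * G i"
  shows "oprod F n * Z n = Z 0 * oprod G n"
  using assms
proof (induction n)
  case (Suc n)
  have "oprod F (Suc n) * Z (Suc n) = oprod F n * (F n * Z (Suc n))" by (simp add: mult.assoc)
  also have "\<dots> = (oprod F n * Z n) * G n" using Suc.prems by (simp add: mult.assoc)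
  also have "\<dots> = Z 0 * oprod G (Suc n)" using Suc by (simp add: mult.assoc)
  finally show ?case .
qed simp

section \<open>Sums over the exponents\<close>

text \<open>
  The column \<open>b\<close> is an integer so that the recurrences, which refer to the column \<open>b - 1\<close>, hold
  without exception at \<open>b = 0\<close>: the index set for column \<open>-1\<close> is empty.
\<close>

definition exponents :: "nat \<Rightarrow> nat \<Rightarrow> int \<Rightarrow> (nat \<times> nat \<times> nat \<times> nat) set" where
  "exponents n a b = {(K, L, M, N). K + M = a \<and> int (K + L) = b \<and> K + L + M + N = n}"

lemma finite_exponents: "finite (exponents n a b)"
  by (rule finite_subset[of _ "{..n} \<times> {..n} \<times> {..n} \<times> {..n}"]) (auto simp: exponents_def)

definition exp_weight :: "nat \<times> nat \<times> nat \<times> nat \<Rightarrow> complex" where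
  "exp_weight = (\<lambda>(K, L, M, N). 1 / (fact K * fact M * fact L * fact N))"

text \<open>
  The identity \<open>d / d! = 1 / (d - 1)!\<close>, summed: \<open>d\<close> selects one of the four exponents and \<open>\<sigma>\<close> raises
  it by one. The four instances below turn a factor \<open>L\<close>, \<open>N\<close>, \<open>K\<close> or \<open>M\<close> in a sum of degree
  \<open>n + 1\<close> into a sum of degree \<open>n\<close>.
\<close>

lemma sum_exp_shift:
  fixes T :: "nat \<times> nat \<times> nat \<times> nat \<Rightarrow> 'a::complex_alg"
  assumes "finite E" and "inj_on \<sigma> E'" and "\<sigma> ` E' = {p \<in> E. d p \<noteq> 0}"
    and "\<And>q. q \<in> E' \<Longrightarrow> of_nat (d (\<sigma> q)) * exp_weight (\<sigma> q) = exp_weight q"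
  shows "(\<Sum>p\<in>E. (of_nat (d p) * exp_weight p) *\<^sub>C T p) = (\<Sum>q\<in>E'. exp_weight q *\<^sub>C T (\<sigma> q))"
proof -
  have "(\<Sum>p\<in>E. (of_nat (d p) * exp_weight p) *\<^sub>C T p)
      = (\<Sum>p\<in>\<sigma> ` E'. (of_nat (d p) * exp_weight p) *\<^sub>C T p)"
    unfolding assms(3) using assms(1) by (intro sum.mono_neutral_right) auto
  also have "\<dots> = (\<Sum>q\<in>E'. exp_weight q *\<^sub>C T (\<sigma> q))"
    using assms(2,4) by (simp add: sum.reindex)
  finally show ?thesis .
qed

lemma sum_exponents_L:
  fixes T :: "nat \<times> nat \<times> nat \<times> nat \<Rightarrow> 'a::complex_alg"
  shows "(\<Sum>p\<in>exponents (Suc n) a b. (of_nat (fst (snd p)) * exp_weight p) *\<^sub>C T p)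
    = (\<Sum>(K, L, M, N)\<in>exponents n a (b - 1). exp_weight (K, L, M, N) *\<^sub>C T (K, Suc L, M, N))"
proof -
  define \<sigma> :: "nat \<times> nat \<times> nat \<times> nat \<Rightarrow> _" where "\<sigma> = (\<lambda>(K, L, M, N). (K, Suc L, M, N))"
  have "\<sigma> ` exponents n a (b - 1) = {p \<in> exponents (Suc n) a b. fst (snd p) \<noteq> 0}"
    by (force simp: \<sigma>_def exponents_def image_iff gr0_conv_Suc)
  then show ?thesis
    by (subst sum_exp_shift[where \<sigma> = \<sigma> and E' = "exponents n a (b - 1)"])
      (auto simp: finite_exponents inj_on_def \<sigma>_def exp_weight_def field_simps simp del: of_nat_Suc intro!: sum.cong)
qed

lemma sum_exponents_N:
  fixes T :: "nat \<times> nat \<times> nat \<times> nat \<Rightarrow> 'a::complex_alg"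
  shows "(\<Sum>p\<in>exponents (Suc n) a b. (of_nat (snd (snd (snd p))) * exp_weight p) *\<^sub>C T p)
    = (\<Sum>(K, L, M, N)\<in>exponents n a b. exp_weight (K, L, M, N) *\<^sub>C T (K, L, M, Suc N))"
proof -
  define \<sigma> :: "nat \<times> nat \<times> nat \<times> nat \<Rightarrow> _" where "\<sigma> = (\<lambda>(K, L, M, N). (K, L, M, Suc N))"
  have "\<sigma> ` exponents n a b = {p \<in> exponents (Suc n) a b. snd (snd (snd p)) \<noteq> 0}"
    by (force simp: \<sigma>_def exponents_def image_iff gr0_conv_Suc)
  then show ?thesis
    by (subst sum_exp_shift[where \<sigma> = \<sigma> and E' = "exponents n a b"])
      (auto simp: finite_exponents inj_on_def \<sigma>_def exp_weight_def field_simps simp del: of_nat_Suc intro!: sum.cong)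
qed

lemma sum_exponents_K:
  fixes T :: "nat \<times> nat \<times> nat \<times> nat \<Rightarrow> 'a::complex_alg"
  shows "(\<Sum>p\<in>exponents (Suc n) (Suc a) b. (of_nat (fst p) * exp_weight p) *\<^sub>C T p)
    = (\<Sum>(K, L, M, N)\<in>exponents n a (b - 1). exp_weight (K, L, M, N) *\<^sub>C T (Suc K, L, M, N))"
proof -
  define \<sigma> :: "nat \<times> nat \<times> nat \<times> nat \<Rightarrow> _" where "\<sigma> = (\<lambda>(K, L, M, N). (Suc K, L, M, N))"
  have "\<sigma> ` exponents n a (b - 1) = {p \<in> exponents (Suc n) (Suc a) b. fst p \<noteq> 0}"
    by (force simp: \<sigma>_def exponents_def image_iff gr0_conv_Suc)
  then show ?thesis
    by (subst sum_exp_shift[where \<sigma> = \<sigma> and E' = "exponents n a (b - 1)"])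
      (auto simp: finite_exponents inj_on_def \<sigma>_def exp_weight_def field_simps simp del: of_nat_Suc intro!: sum.cong)
qed

lemma sum_exponents_M:
  fixes T :: "nat \<times> nat \<times> nat \<times> nat \<Rightarrow> 'a::complex_alg"
  shows "(\<Sum>p\<in>exponents (Suc n) (Suc a) b. (of_nat (fst (snd (snd p))) * exp_weight p) *\<^sub>C T p)
    = (\<Sum>(K, L, M, N)\<in>exponents n a b. exp_weight (K, L, M, N) *\<^sub>C T (K, L, Suc M, N))"
proof -
  define \<sigma> :: "nat \<times> nat \<times> nat \<times> nat \<Rightarrow> _" where "\<sigma> = (\<lambda>(K, L, M, N). (K, L, Suc M, N))"
  have "\<sigma> ` exponents n a b = {p \<in> exponents (Suc n) (Suc a) b. fst (snd (snd p)) \<noteq> 0}"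
    by (force simp: \<sigma>_def exponents_def image_iff gr0_conv_Suc)
  then show ?thesis
    by (subst sum_exp_shift[where \<sigma> = \<sigma> and E' = "exponents n a b"])
      (auto simp: finite_exponents inj_on_def \<sigma>_def exp_weight_def field_simps simp del: of_nat_Suc intro!: sum.cong)
qed

section \<open>Exchange relations\<close>

locale jordanian_matrix =
  fixes h :: complex and x y u v :: "'a::complex_alg"
  assumes rel_vx: "v * x - x * v = h *\<^sub>C (v * v)"
    and rel_ux: "u * x - x * u = h *\<^sub>C ((x * y - u * v - h *\<^sub>C (x * v)) - x * x)"
    and rel_vy: "v * y - y * v = h *\<^sub>C (v * v)"
    and rel_uy: "u * y - y * u = h *\<^sub>C ((x * y - u * v - h *\<^sub>C (x * v)) - y * y)"
    and rel_xy: "x * y - y * x = h *\<^sub>C (x * v - y * v)"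
    and rel_vu: "v * u - u * v = h *\<^sub>C (x * v + v * y)"
begin

text \<open>
  The relations, solved for the words that are not in the order \<open>u, x, y, v\<close>. On quadratic
  expressions this is a terminating rewrite system, and comparing normal forms proves every
  quadratic identity below.
\<close>

lemma normal_order:
  "v * x = x * v + h *\<^sub>C (v * v)"
  "v * y = y * v + h *\<^sub>C (v * v)"
  "v * u = u * v + h *\<^sub>C (x * v) + h *\<^sub>C (y * v) + (h * h) *\<^sub>C (v * v)"
  "y * x = x * y - h *\<^sub>C (x * v) + h *\<^sub>C (y * v)"
  "x * u = u * x - h *\<^sub>C (x * y) + h *\<^sub>C (u * v) + (h * h) *\<^sub>C (x * v) + h *\<^sub>C (x * x)"
  "y * u = u * y - h *\<^sub>C (x * y) + h *\<^sub>C (u * v) + (h * h) *\<^sub>C (x * v) + h *\<^sub>C (y * y)"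
  using rel_vx rel_ux rel_vy rel_uy rel_xy rel_vu
  by (auto simp: algebra_simps)

text \<open>
  With \<open>T\<close> the matrix with rows \<open>(x, u)\<close> and \<open>(v, y)\<close>, the elements \<open>X a\<close>, \<open>Y b\<close> and \<open>W a b\<close> are
  \<open>(1, a) T (1, 0)\<close>, \<open>(0, 1) T (-b, 1)\<close> and \<open>(1, a) T (-b, 1)\<close>, and \<open>v\<close> is \<open>(0, 1) T (1, 0)\<close>: the
  parameter \<open>a\<close> shears the rows and \<open>b\<close> the columns. In the coproduct computation \<open>a\<close> belongs to the
  row index and \<open>b\<close> to the column index.
\<close>

definition X where "X a = x + a *\<^sub>C v"
definition Y where "Y b = y - b *\<^sub>C v"
definition W where "W a b = u - b *\<^sub>C x + a *\<^sub>C y - (a * b) *\<^sub>C v"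

lemma v_X: "v * X a = X (a + h) * v"
  and Y_v: "Y b * v = v * Y (b + h)"
  and W_v: "W (a + h) (b - h) * v = v * W a b"
  and W_X: "W a b * X (a + h) = X a * W (a + h) (b + h)"
  and Y_W: "Y (b + h) * W a b = W (a + h) (b + h) * Y b"
  and Y_X: "Y (b - h) * X a = X (a + h) * Y b"
  unfolding X_def Y_def W_def
  by (simp_all add: normal_order scl_expand algebra_simps)

section \<open>The two forms of a monomial\<close>

definition term1 :: "nat \<Rightarrow> nat \<Rightarrow> nat \<Rightarrow> nat \<Rightarrow> 'a" where
  "term1 K L M N = oprod (\<lambda>i. X (h * of_nat i)) K * v ^ L
     * oprod (\<lambda>i. W (h * (of_nat K - of_nat L + of_nat i)) (h * (of_nat K + of_nat L - of_nat i))) M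
     * oprod (\<lambda>i. Y (h * (of_nat K + of_nat L - of_nat M - of_nat i))) N"

definition term2 :: "nat \<Rightarrow> nat \<Rightarrow> nat \<Rightarrow> nat \<Rightarrow> 'a" where
  "term2 K L M N = oprod (\<lambda>i. W (h * of_nat i) (- (h * of_nat i))) M
     * oprod (\<lambda>i. X (h * (of_nat M + of_nat i))) K
     * oprod (\<lambda>i. Y (h * (of_nat K - of_nat M - of_nat i))) N * v ^ L"

lemma v_pow_X: "v ^ L * X a = X (a + of_nat L * h) * v ^ L"
proof (induction L)
  case (Suc L)
  have "v ^ Suc L * X a = v * (v ^ L * X a)" by (simp add: mult.assoc)
  also have "\<dots> = (v * X (a + of_nat L * h)) * v ^ L" by (simp add: Suc mult.assoc)
  also have "\<dots> = X (a + of_nat (Suc L) * h) * v ^ Suc L"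
    by (simp add: v_X mult.assoc algebra_simps)
  finally show ?case .
qed simp

lemma v_pow_W: "v ^ L * W a b = W (a + of_nat L * h) (b - of_nat L * h) * v ^ L"
proof (induction L)
  case (Suc L)
  have "v ^ Suc L * W a b = v * (v ^ L * W a b)" by (simp add: mult.assoc)
  also have "\<dots> = (v * W (a + of_nat L * h) (b - of_nat L * h)) * v ^ L"
    by (simp add: Suc mult.assoc)
  also have "\<dots> = W (a + of_nat (Suc L) * h) (b - of_nat (Suc L) * h) * v ^ Suc L"
    by (simp add: W_v[symmetric] mult.assoc algebra_simps)
  finally show ?case .
qed simp

text \<open>
  Moving \<open>v\<close> to the left through the \<open>Y\<close> and \<open>W\<close> factors changes their parameters exactly as
  replacing \<open>L\<close> by \<open>L + 1\<close> does.
\<close>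

lemma term1_v: "term1 K L M N * v = term1 K (Suc L) M N"
proof -
  let ?U = "\<lambda>L i. W (h * (of_nat K - of_nat L + of_nat i)) (h * (of_nat K + of_nat L - of_nat i))"
  let ?Y = "\<lambda>L i. Y (h * (of_nat K + of_nat L - of_nat M - of_nat i))"
  have Y: "oprod (?Y L) N * v = v * oprod (?Y (Suc L)) N"
    by (rule oprod_exchange[where Z = "\<lambda>_. v"]) (simp add: Y_v algebra_simps)
  have U: "oprod (?U L) M * v = v * oprod (?U (Suc L)) M"
  proof (rule oprod_exchange[where Z = "\<lambda>_. v"])
    show "?U L i * v = v * ?U (Suc L) i" for i
      using W_v[of "h * (of_nat K - of_nat (Suc L) + of_nat i)" "h * (of_nat K + of_nat (Suc L) - of_nat i)"]
      by (simp add: algebra_simps)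
  qed
  have "term1 K L M N * v = oprod (\<lambda>i. X (h * of_nat i)) K * v ^ L * oprod (?U L) M * (oprod (?Y L) N * v)"
    by (simp add: term1_def mult.assoc)
  also have "\<dots> = oprod (\<lambda>i. X (h * of_nat i)) K * v ^ L * (oprod (?U L) M * v) * oprod (?Y (Suc L)) N"
    unfolding Y by (simp add: mult.assoc)
  also have "\<dots> = term1 K (Suc L) M N"
    unfolding U by (simp add: term1_def mult.assoc power_Suc2 del: power_Suc)
  finally show ?thesis .
qed

lemma term1_Y: "term1 K L M N * Y (h * (of_nat K + of_nat L - of_nat M - of_nat N)) = term1 K L M (Suc N)"
  by (simp add: term1_def mult.assoc)

lemma term1_W: "term1 K 0 M 0 * W (h * (of_nat K + of_nat M)) (h * (of_nat K - of_nat M)) = term1 K 0 (Suc M) 0"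
  by (simp add: term1_def mult.assoc)

text \<open>
  The factor \<open>X\<close> travels through all \<open>W\<close> factors and arrives with the parameter that the next factor
  of the leading product of \<open>X\<close> factors must have.
\<close>

lemma term1_X: "term1 K 0 M 0 * X (h * (of_nat K + of_nat M)) = term1 (Suc K) 0 M 0"
proof -
  let ?U = "\<lambda>K i. W (h * (of_nat K + of_nat i)) (h * (of_nat K - of_nat i))"
  have "oprod (?U K) M * X (h * (of_nat K + of_nat M)) = X (h * (of_nat K + of_nat 0)) * oprod (?U (Suc K)) M"
  proof (rule oprod_exchange[where Z = "\<lambda>i. X (h * (of_nat K + of_nat i))"])
    show "?U K i * X (h * (of_nat K + of_nat (Suc i))) = X (h * (of_nat K + of_nat i)) * ?U (Suc K) i" for i
      using W_X[of "h * (of_nat K + of_nat i)" "h * (of_nat K - of_nat i)"]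
      by (simp add: algebra_simps)
  qed
  then show ?thesis
    by (simp add: term1_def mult.assoc)
qed

text \<open>
  For \<open>K = L = N = 0\<close> both forms are the same product of \<open>W\<close> factors. Then \<open>K\<close>, \<open>N\<close> and \<open>L\<close> are raised
  in the order in which their factors appear in the second form, where every step just appends a
  factor; the exchange relations provide the same steps for the first form.
\<close>

lemma term1_eq_term2: "term1 K L M N = term2 K L M N"
proof -
  have KM: "term1 K 0 M 0 = term2 K 0 M 0"
  proof (induction K)
    case 0
    show ?case by (simp add: term1_def term2_def)
  next
    case (Suc K)
    have "term2 (Suc K) 0 M 0 = term2 K 0 M 0 * X (h * (of_nat K + of_nat M))"
      by (simp add: term2_def mult.assoc add.commute)
    with Suc term1_X[of K M] show ?case by simp
  qed
  have KMN: "term1 K 0 M N = term2 K 0 M N"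
  proof (induction N)
    case (Suc N)
    have "term2 K 0 M (Suc N) = term2 K 0 M N * Y (h * (of_nat K - of_nat M - of_nat N))"
      by (simp add: term2_def mult.assoc)
    with Suc term1_Y[of K 0 M N] show ?case by simp
  qed (rule KM)
  show ?thesis
  proof (induction L)
    case (Suc L)
    have "term2 K (Suc L) M N = term2 K L M N * v"
      by (simp add: term2_def mult.assoc power_Suc2 del: power_Suc)
    with Suc term1_v[of K L M N] show ?case by simp
  qed (rule KMN)
qed

text \<open>
  For arbitrary exponents the multiplication by \<open>X\<close> or \<open>W\<close> is easy in the second form: the factor
  passes \<open>v ^ L\<close> and the \<open>Y\<close> factors by shifts only. For \<open>W\<close> the remaining product is then
  \<open>term2 K 0 M 0\<close>, on which the first form takes over.
\<close>

lemma term2_X: "term2 K L M N * X (h * (of_nat K + of_nat M - of_nat L - of_nat N)) = term2 (Suc K) L M N"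
proof -
  let ?Y = "\<lambda>K i. Y (h * (of_nat K - of_nat M - of_nat i))"
  let ?Z = "\<lambda>i. X (h * (of_nat K + of_nat M - of_nat i))"
  let ?UX = "oprod (\<lambda>i. W (h * of_nat i) (- (h * of_nat i))) M * oprod (\<lambda>i. X (h * (of_nat M + of_nat i))) K"
  have Y: "oprod (?Y K) N * ?Z N = ?Z 0 * oprod (?Y (Suc K)) N"
  proof (rule oprod_exchange[where Z = ?Z])
    show "?Y K i * ?Z (Suc i) = ?Z i * ?Y (Suc K) i" for i
      using Y_X[of "h * (of_nat (Suc K) - of_nat M - of_nat i)" "h * (of_nat K + of_nat M - of_nat (Suc i))"]
      by (simp add: algebra_simps)
  qed
  have v: "v ^ L * X (h * (of_nat K + of_nat M - of_nat L - of_nat N)) = ?Z N * v ^ L"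
    unfolding v_pow_X by (simp add: algebra_simps)
  have "term2 K L M N * X (h * (of_nat K + of_nat M - of_nat L - of_nat N)) = ?UX * (oprod (?Y K) N * ?Z N) * v ^ L"
    by (simp add: term2_def mult.assoc v)
  also have "\<dots> = term2 (Suc K) L M N"
    unfolding Y by (simp add: term2_def mult.assoc add.commute)
  finally show ?thesis .
qed

lemma term2_W: "term2 K L M N * W (h * (of_nat K + of_nat M - of_nat L - of_nat N)) (h * (of_nat K + of_nat L - of_nat M - of_nat N))
  = term2 K L (Suc M) N"
proof -
  let ?Y = "\<lambda>M i. Y (h * (of_nat K - of_nat M - of_nat i))"
  let ?Z = "\<lambda>i. W (h * (of_nat K + of_nat M - of_nat i)) (h * (of_nat K - of_nat M - of_nat i))"
  let ?UX = "oprod (\<lambda>i. W (h * of_nat i) (- (h * of_nat i))) M * oprod (\<lambda>i. X (h * (of_nat M + of_nat i))) K"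
  have Y: "oprod (?Y M) N * ?Z N = ?Z 0 * oprod (?Y (Suc M)) N"
  proof (rule oprod_exchange[where Z = ?Z])
    show "?Y M i * ?Z (Suc i) = ?Z i * ?Y (Suc M) i" for i
      using Y_W[of "h * (of_nat K - of_nat (Suc M) - of_nat i)" "h * (of_nat K + of_nat M - of_nat (Suc i))"]
      by (simp add: algebra_simps)
  qed
  have v: "v ^ L * W (h * (of_nat K + of_nat M - of_nat L - of_nat N)) (h * (of_nat K + of_nat L - of_nat M - of_nat N)) = ?Z N * v ^ L"
    unfolding v_pow_W by (simp add: algebra_simps)
  have UX: "?UX * ?Z 0 = term2 K 0 (Suc M) 0"
    using term1_W[of K M] by (simp add: term1_eq_term2) (simp add: term2_def)
  have "term2 K L M N * W (h * (of_nat K + of_nat M - of_nat L - of_nat N)) (h * (of_nat K + of_nat L - of_nat M - of_nat N))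
     = ?UX * (oprod (?Y M) N * ?Z N) * v ^ L"
    by (simp add: term2_def mult.assoc v)
  also have "\<dots> = (?UX * ?Z 0) * oprod (?Y (Suc M)) N * v ^ L"
    unfolding Y by (simp add: mult.assoc)
  also have "\<dots> = term2 K L (Suc M) N"
    unfolding UX by (simp add: term2_def mult.assoc)
  finally show ?thesis .
qed

section \<open>Recurrences for the matrix elements\<close>

text \<open>
  For spin \<open>n / 2\<close> these are the \<open>D\<close>-functions up to the square root in front; row and column are
  counted from \<open>0\<close>, so that the weight \<open>m\<close> corresponds to \<open>n / 2 + m\<close>.
\<close>

definition matrix_elem :: "nat \<Rightarrow> nat \<Rightarrow> int \<Rightarrow> 'a" where
  "matrix_elem n a b = (\<Sum>(K, L, M, N)\<in>exponents n a b. exp_weight (K, L, M, N) *\<^sub>C term1 K L M N)"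

abbreviation wt :: "nat \<Rightarrow> int \<Rightarrow> complex" where
  "wt n b \<equiv> h * (2 * of_int b - of_nat n)"

lemma wt_exponents:
  assumes "(K, L, M, N) \<in> exponents n a b"
  shows "h * (of_nat K + of_nat L - of_nat M - of_nat N) = wt n b"
    and "h * (of_nat K + of_nat M - of_nat L - of_nat N) = wt n (int a)"
  using assms by (auto simp: exponents_def)

text \<open>
  Here \<open>n + 1 - a = L + N\<close> on the index set, and \<open>L\<close> and \<open>N\<close> each cancel one factor of the weight;
  in the next lemma the same happens with \<open>a + 1 = K + M\<close>.
\<close>

lemma matrix_elem_lower:
  assumes "a \<le> n"
  shows "of_nat (Suc n - a) *\<^sub>C matrix_elem (Suc n) a b = matrix_elem n a (b - 1) * v + matrix_elem n a b * Y (wt n b)"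
proof -
  let ?E = "exponents (Suc n) a b"
  define T where "T = (\<lambda>(K, L, M, N). term1 K L M N)"
  have "of_nat (Suc n - a) *\<^sub>C matrix_elem (Suc n) a b
      = (\<Sum>p\<in>?E. (of_nat (fst (snd p)) * exp_weight p) *\<^sub>C T p) + (\<Sum>p\<in>?E. (of_nat (snd (snd (snd p))) * exp_weight p) *\<^sub>C T p)"
    unfolding matrix_elem_def complex_alg.scale_sum_right sum.distrib[symmetric]
  proof (rule sum.cong[OF refl], clarify)
    fix K L M N assume "(K, L, M, N) \<in> ?E"
    then have "Suc n - a = fst (snd (K, L, M, N)) + snd (snd (snd (K, L, M, N)))" by (auto simp: exponents_def)
    then show "of_nat (Suc n - a) *\<^sub>C exp_weight (K, L, M, N) *\<^sub>C term1 K L M N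
      = (of_nat (fst (snd (K, L, M, N))) * exp_weight (K, L, M, N)) *\<^sub>C T (K, L, M, N)
      + (of_nat (snd (snd (snd (K, L, M, N)))) * exp_weight (K, L, M, N)) *\<^sub>C T (K, L, M, N)"
      by (simp only: T_def prod.case scl_scl scl_add_left[symmetric] of_nat_add distrib_right)
  qed
  also have "(\<Sum>p\<in>?E. (of_nat (fst (snd p)) * exp_weight p) *\<^sub>C T p) = matrix_elem n a (b - 1) * v"
    unfolding sum_exponents_L matrix_elem_def sum_distrib_right
    by (rule sum.cong) (auto simp: T_def scl_mult_left term1_v)
  also have "(\<Sum>p\<in>?E. (of_nat (snd (snd (snd p))) * exp_weight p) *\<^sub>C T p) = matrix_elem n a b * Y (wt n b)"
    unfolding sum_exponents_N matrix_elem_def sum_distrib_right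
    by (rule sum.cong) (auto simp: T_def scl_mult_left term1_Y simp flip: wt_exponents(1))
  finally show ?thesis .
qed

lemma matrix_elem_raise:
  "of_nat (Suc a) *\<^sub>C matrix_elem (Suc n) (Suc a) b = matrix_elem n a (b - 1) * X (wt n (int a)) + matrix_elem n a b * W (wt n (int a)) (wt n b)"
proof -
  let ?E = "exponents (Suc n) (Suc a) b"
  define T where "T = (\<lambda>(K, L, M, N). term1 K L M N)"
  have "of_nat (Suc a) *\<^sub>C matrix_elem (Suc n) (Suc a) b
      = (\<Sum>p\<in>?E. (of_nat (fst p) * exp_weight p) *\<^sub>C T p) + (\<Sum>p\<in>?E. (of_nat (fst (snd (snd p))) * exp_weight p) *\<^sub>C T p)"
    unfolding matrix_elem_def complex_alg.scale_sum_right sum.distrib[symmetric]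
  proof (rule sum.cong[OF refl], clarify)
    fix K L M N assume "(K, L, M, N) \<in> ?E"
    then have "Suc a = fst (K, L, M, N) + fst (snd (snd (K, L, M, N)))" by (auto simp: exponents_def)
    then show "of_nat (Suc a) *\<^sub>C exp_weight (K, L, M, N) *\<^sub>C term1 K L M N
      = (of_nat (fst (K, L, M, N)) * exp_weight (K, L, M, N)) *\<^sub>C T (K, L, M, N)
      + (of_nat (fst (snd (snd (K, L, M, N)))) * exp_weight (K, L, M, N)) *\<^sub>C T (K, L, M, N)"
      by (simp only: T_def prod.case scl_scl scl_add_left[symmetric] of_nat_add distrib_right)
  qed
  also have "(\<Sum>p\<in>?E. (of_nat (fst p) * exp_weight p) *\<^sub>C T p) = matrix_elem n a (b - 1) * X (wt n (int a))"
    unfolding sum_exponents_K matrix_elem_def sum_distrib_right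
  proof (rule sum.cong[OF refl], clarify)
    fix K L M N assume E: "(K, L, M, N) \<in> exponents n a (b - 1)"
    show "exp_weight (K, L, M, N) *\<^sub>C T (Suc K, L, M, N)
      = (exp_weight (K, L, M, N) *\<^sub>C term1 K L M N) * X (wt n (int a))"
      unfolding wt_exponents(2)[OF E, symmetric] by (simp add: T_def scl_mult_left term1_eq_term2 term2_X)
  qed
  also have "(\<Sum>p\<in>?E. (of_nat (fst (snd (snd p))) * exp_weight p) *\<^sub>C T p) = matrix_elem n a b * W (wt n (int a)) (wt n b)"
    unfolding sum_exponents_M matrix_elem_def sum_distrib_right
  proof (rule sum.cong[OF refl], clarify)
    fix K L M N assume E: "(K, L, M, N) \<in> exponents n a b"
    show "exp_weight (K, L, M, N) *\<^sub>C T (K, L, Suc M, N)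
      = (exp_weight (K, L, M, N) *\<^sub>C term1 K L M N) * W (wt n (int a)) (wt n b)"
      unfolding wt_exponents[OF E, symmetric] by (simp add: T_def scl_mult_left term1_eq_term2 term2_W)
  qed
  finally show ?thesis .
qed

lemma matrix_elem_out_of_range: "int n < b \<or> b < 0 \<Longrightarrow> matrix_elem n a b = 0"
  by (auto simp: matrix_elem_def exponents_def intro!: sum.neutral)

lemma matrix_elem_0: "matrix_elem 0 0 b = (if b = 0 then 1 else 0)"
proof -
  have "exponents 0 0 b = (if b = 0 then {(0, 0, 0, 0)} else {})"
    by (auto simp: exponents_def)
  then show ?thesis
    by (simp add: matrix_elem_def exp_weight_def term1_def scl_one)
qed

end

section \<open>Coproduct\<close>

locale tensor_pair =
  A: jordanian_matrix h x y u v for h x y u and v :: "'a::complex_alg" +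
  fixes \<tau> :: "'a \<Rightarrow> 'a \<Rightarrow> 'b::complex_alg"
  assumes \<tau>_add_left: "\<tau> (a + a') b = \<tau> a b + \<tau> a' b"
    and \<tau>_add_right: "\<tau> a (b + b') = \<tau> a b + \<tau> a b'"
    and \<tau>_scl_left: "\<tau> (c *\<^sub>C a) b = c *\<^sub>C \<tau> a b"
    and \<tau>_scl_right: "\<tau> a (c *\<^sub>C b) = c *\<^sub>C \<tau> a b"
    and \<tau>_mult: "\<tau> a b * \<tau> a' b' = \<tau> (a * a') (b * b')"
begin

lemma \<tau>_diff_left: "\<tau> (a - a') b = \<tau> a b - \<tau> a' b"
  using \<tau>_add_left[of "a - a'" a' b] by (simp add: algebra_simps)

lemma \<tau>_diff_right: "\<tau> a (b - b') = \<tau> a b - \<tau> a b'"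
  using \<tau>_add_right[of a "b - b'" b'] by (simp add: algebra_simps)

lemmas \<tau>_expand = \<tau>_add_left \<tau>_add_right \<tau>_scl_left \<tau>_scl_right \<tau>_diff_left \<tau>_diff_right

text \<open>
  The quantum determinant is group-like. Both this and the next lemma compare normal forms in both
  tensor factors.
\<close>

lemma det: "(\<tau> x x + \<tau> u v) * (\<tau> v u + \<tau> y y) - (\<tau> x u + \<tau> u y) * (\<tau> v x + \<tau> y v)
    - h *\<^sub>C ((\<tau> x x + \<tau> u v) * (\<tau> v x + \<tau> y v))
   = \<tau> (x * y - u * v - h *\<^sub>C (x * v)) (x * y - u * v - h *\<^sub>C (x * v))"
  by (simp add: A.normal_order \<tau>_mult \<tau>_expand scl_expand algebra_simps)

text \<open>
  The reason why the coproduct is well defined on the quotient by the relations.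
\<close>

lemma prod_jordanian: "jordanian_matrix h (\<tau> x x + \<tau> u v) (\<tau> v u + \<tau> y y) (\<tau> x u + \<tau> u y) (\<tau> v x + \<tau> y v)"
  by unfold_locales (simp_all add: A.normal_order \<tau>_mult \<tau>_expand scl_expand algebra_simps)

end

text \<open>
  The condition on \<open>1\<close> reads \<open>\<Delta> 1 = \<tau> 1 1\<close> instead of \<open>\<Delta> 1 = 1\<close> because the maps to which the locale
  is applied send \<open>1\<close> to an idempotent that is supported on a single algebra.
\<close>

locale jordanian_comultiplication = tensor_pair h x y u v \<tau>
  for h and \<tau> :: "'a::complex_alg \<Rightarrow> 'a \<Rightarrow> 'b::complex_alg" and x y u v +
  fixes \<Delta> :: "'a \<Rightarrow> 'b"
  assumes \<Delta>_add: "\<Delta> (a + b) = \<Delta> a + \<Delta> b"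
    and \<Delta>_scl: "\<Delta> (c *\<^sub>C a) = c *\<^sub>C \<Delta> a"
    and \<Delta>_mult: "\<Delta> (a * b) = \<Delta> a * \<Delta> b"
    and \<Delta>_1: "\<Delta> 1 = \<tau> 1 1"
    and \<Delta>_x: "\<Delta> x = \<tau> x x + \<tau> u v"
    and \<Delta>_y: "\<Delta> y = \<tau> v u + \<tau> y y"
    and \<Delta>_u: "\<Delta> u = \<tau> x u + \<tau> u y"
    and \<Delta>_v: "\<Delta> v = \<tau> v x + \<tau> y v"
begin

abbreviation fact_pair :: "nat \<Rightarrow> nat \<Rightarrow> complex" where
  "fact_pair n k \<equiv> fact k * fact (n - k)"

abbreviation f where "f \<equiv> A.matrix_elem"

lemma \<tau>_zero_left [simp]: "\<tau> 0 b = 0"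
  using \<tau>_diff_left[of 0 0 b] by simp

lemma \<Delta>_diff: "\<Delta> (a - b) = \<Delta> a - \<Delta> b"
  using \<Delta>_add[of "a - b" b] by (simp add: algebra_simps)

text \<open>
  The induction step for both recurrences at once: \<open>(p, q)\<close> is \<open>(v, y)\<close> for the first one and
  \<open>(X \<alpha>, u + \<alpha> y)\<close> for the second one, that is, a row of \<open>T\<close> after a row shear, and \<open>P\<close> and \<open>Q\<close> are
  the coproducts of \<open>p\<close> and \<open>q\<close>. In the second tensor factor both recurrences are needed, to express
  the multiplications by the rows \<open>(x, u)\<close> and \<open>(v, y)\<close> of \<open>T\<close> through the elements of degree \<open>n + 1\<close> in
  the rows \<open>k\<close> and \<open>k + 1\<close>.
\<close>

lemma tensor_step:
  fixes p q :: 'a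
  defines "P \<equiv> \<tau> p x + \<tau> q v" and "Q \<equiv> \<tau> p u + \<tau> q y"
  shows "(\<Sum>k\<le>n. fact_pair n k *\<^sub>C \<tau> (f n a (int k)) (f n k (b - 1))) * P
       + (\<Sum>k\<le>n. fact_pair n k *\<^sub>C \<tau> (f n a (int k)) (f n k b)) * (Q - A.wt n b *\<^sub>C P)
       = (\<Sum>k\<le>Suc n. fact_pair (Suc n) k *\<^sub>C
           \<tau> (f n a (int k - 1) * p + f n a (int k) * (q - A.wt n (int k) *\<^sub>C p)) (f (Suc n) k b))"
    (is "?lhs = ?rhs")
proof -
  let ?\<alpha> = "\<lambda>k. A.wt n (int k)"
  have step: "(fact_pair n k *\<^sub>C \<tau> (f n a (int k)) (f n k (b - 1))) * P
       + (fact_pair n k *\<^sub>C \<tau> (f n a (int k)) (f n k b)) * (Q - A.wt n b *\<^sub>C P)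
     = fact_pair (Suc n) (Suc k) *\<^sub>C \<tau> (f n a (int k) * p) (f (Suc n) (Suc k) b)
     + fact_pair (Suc n) k *\<^sub>C \<tau> (f n a (int k) * (q - ?\<alpha> k *\<^sub>C p)) (f (Suc n) k b)"
    if "k \<le> n" for k
  proof -
    let ?g = "f n a (int k)"
    define G where "G = f n k (b - 1) * x + f n k b * (u - A.wt n b *\<^sub>C x)"
    define H where "H = f n k (b - 1) * v + f n k b * A.Y (A.wt n b)"
    have H: "H = of_nat (Suc n - k) *\<^sub>C f (Suc n) k b"
      unfolding H_def using A.matrix_elem_lower[OF that] by simp
    \<comment> \<open>\<open>G\<close> and \<open>H\<close> come from the two rows of \<open>T\<close>; \<open>X\<close> and \<open>W\<close> are the first row plus \<open>\<alpha>\<close> times the second\<close>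
    have "G + ?\<alpha> k *\<^sub>C H = of_nat (Suc k) *\<^sub>C f (Suc n) (Suc k) b"
      unfolding A.matrix_elem_raise G_def H_def A.X_def A.Y_def A.W_def
      by (simp add: algebra_simps scl_expand)
    then have G: "G = of_nat (Suc k) *\<^sub>C f (Suc n) (Suc k) b - ?\<alpha> k *\<^sub>C H"
      by (simp add: algebra_simps)
    have c: "fact_pair (Suc n) (Suc k) = fact_pair n k * of_nat (Suc k)" "fact_pair (Suc n) k = fact_pair n k * of_nat (Suc n - k)"
      using that by (simp_all add: Suc_diff_le)
    have "\<tau> ?g (f n k (b - 1)) * P + \<tau> ?g (f n k b) * (Q - A.wt n b *\<^sub>C P) = \<tau> (?g * p) G + \<tau> (?g * q) H"
      unfolding P_def Q_def G_def H_def A.Y_def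
      by (simp add: \<tau>_expand \<tau>_mult scl_expand algebra_simps)
    also have "\<dots> = \<tau> (?g * p) (of_nat (Suc k) *\<^sub>C f (Suc n) (Suc k) b) + \<tau> (?g * (q - ?\<alpha> k *\<^sub>C p)) H"
      unfolding G by (simp add: \<tau>_expand scl_expand right_diff_distrib)
    also have "\<dots> = of_nat (Suc k) *\<^sub>C \<tau> (?g * p) (f (Suc n) (Suc k) b)
        + of_nat (Suc n - k) *\<^sub>C \<tau> (?g * (q - ?\<alpha> k *\<^sub>C p)) (f (Suc n) k b)"
      unfolding H by (simp only: \<tau>_scl_right)
    finally have "fact_pair n k *\<^sub>C (\<tau> ?g (f n k (b - 1)) * P + \<tau> ?g (f n k b) * (Q - A.wt n b *\<^sub>C P))
      = fact_pair n k *\<^sub>C (of_nat (Suc k) *\<^sub>C \<tau> (?g * p) (f (Suc n) (Suc k) b)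
        + of_nat (Suc n - k) *\<^sub>C \<tau> (?g * (q - ?\<alpha> k *\<^sub>C p)) (f (Suc n) k b))"
      by (rule arg_cong)
    then show ?thesis
      unfolding c by (simp only: scl_add_right scl_scl scl_mult_left)
  qed
  have "?lhs = (\<Sum>k\<le>n. fact_pair (Suc n) (Suc k) *\<^sub>C \<tau> (f n a (int k) * p) (f (Suc n) (Suc k) b))
     + (\<Sum>k\<le>n. fact_pair (Suc n) k *\<^sub>C \<tau> (f n a (int k) * (q - ?\<alpha> k *\<^sub>C p)) (f (Suc n) k b))"
    unfolding sum_distrib_right sum.distrib[symmetric] by (rule sum.cong) (simp_all add: step)
  \<comment> \<open>the added summands vanish: \<open>f n a (-1) = 0\<close> here and \<open>f n a (n + 1) = 0\<close> in the other sum\<close>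
  also have "(\<Sum>k\<le>n. fact_pair (Suc n) (Suc k) *\<^sub>C \<tau> (f n a (int k) * p) (f (Suc n) (Suc k) b))
     = (\<Sum>k\<le>Suc n. fact_pair (Suc n) k *\<^sub>C \<tau> (f n a (int k - 1) * p) (f (Suc n) k b))"
    unfolding sum.atMost_Suc_shift by (simp add: A.matrix_elem_out_of_range)
  also have "(\<Sum>k\<le>n. fact_pair (Suc n) k *\<^sub>C \<tau> (f n a (int k) * (q - ?\<alpha> k *\<^sub>C p)) (f (Suc n) k b))
     = (\<Sum>k\<le>Suc n. fact_pair (Suc n) k *\<^sub>C \<tau> (f n a (int k) * (q - ?\<alpha> k *\<^sub>C p)) (f (Suc n) k b))"
    by (simp add: A.matrix_elem_out_of_range)
  finally show ?thesis
    by (simp only: sum.distrib[symmetric] \<tau>_add_left scl_add_right)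
qed

text \<open>
  Induction on the degree. The row \<open>a = n + 1\<close> cannot be reached by the first recurrence, whose
  coefficient vanishes there; the second recurrence covers it.
\<close>

theorem comult_matrix_elem:
  "a \<le> n \<Longrightarrow> \<Delta> (f n a b) = (\<Sum>k\<le>n. fact_pair n k *\<^sub>C \<tau> (f n a (int k)) (f n k b))"
proof (induction n arbitrary: a b)
  case 0
  have "\<Delta> 0 = 0" using \<Delta>_diff[of 0 0] by simp
  moreover have "\<tau> 1 0 = 0" using \<tau>_diff_right[of 1 0 0] by simp
  ultimately show ?case using 0 by (simp add: A.matrix_elem_0 \<Delta>_1 scl_one)
next
  case (Suc n)
  have \<Delta>Y: "\<Delta> (A.Y c) = (\<tau> v u + \<tau> y y) - c *\<^sub>C (\<tau> v x + \<tau> y v)" for c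
    by (simp add: A.Y_def \<Delta>_diff \<Delta>_scl \<Delta>_y \<Delta>_v)
  show ?case
  proof (cases "a \<le> n")
    case True
    have "of_nat (Suc n - a) *\<^sub>C \<Delta> (f (Suc n) a b)
        = \<Delta> (f n a (b - 1)) * \<Delta> v + \<Delta> (f n a b) * \<Delta> (A.Y (A.wt n b))"
      by (simp only: A.matrix_elem_lower[OF True] \<Delta>_scl[symmetric] \<Delta>_add \<Delta>_mult)
    also have "\<dots> = (\<Sum>k\<le>Suc n. fact_pair (Suc n) k *\<^sub>C
       \<tau> (f n a (int k - 1) * v + f n a (int k) * (y - A.wt n (int k) *\<^sub>C v)) (f (Suc n) k b))"
      unfolding Suc.IH[OF True] \<Delta>Y \<Delta>_v by (rule tensor_step)
    also have "\<dots> = of_nat (Suc n - a) *\<^sub>C (\<Sum>k\<le>Suc n. fact_pair (Suc n) k *\<^sub>C \<tau> (f (Suc n) a (int k)) (f (Suc n) k b))"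
      unfolding complex_alg.scale_sum_right A.Y_def[symmetric] A.matrix_elem_lower[OF True, symmetric]
      by (simp only: \<tau>_scl_left scl_scl mult.commute)
    finally have "inverse (of_nat (Suc n - a)) *\<^sub>C of_nat (Suc n - a) *\<^sub>C \<Delta> (f (Suc n) a b)
      = inverse (of_nat (Suc n - a)) *\<^sub>C of_nat (Suc n - a) *\<^sub>C (\<Sum>k\<le>Suc n. fact_pair (Suc n) k *\<^sub>C \<tau> (f (Suc n) a (int k)) (f (Suc n) k b))"
      by (rule arg_cong)
    moreover have "inverse (of_nat (Suc n - a)) * of_nat (Suc n - a) = (1::complex)"
      using True by (simp del: of_nat_Suc of_nat_diff)
    ultimately show ?thesis by (simp only: scl_scl scl_one)
  next
    case False
    with Suc.prems have a: "a = Suc n" by simp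
    let ?\<alpha> = "A.wt n (int n)"
    let ?p = "A.X ?\<alpha>" and ?q = "u + ?\<alpha> *\<^sub>C y"
    have \<Delta>X: "\<Delta> ?p = \<tau> ?p x + \<tau> ?q v"
      by (simp add: A.X_def \<Delta>_add \<Delta>_scl \<Delta>_x \<Delta>_v \<tau>_expand algebra_simps)
    have W: "A.W ?\<alpha> c = ?q - c *\<^sub>C ?p" for c
      by (simp add: A.W_def A.X_def algebra_simps)
    have \<Delta>W: "\<Delta> (A.W ?\<alpha> c) = (\<tau> ?p u + \<tau> ?q y) - c *\<^sub>C (\<tau> ?p x + \<tau> ?q v)" for c
      unfolding W \<Delta>_diff \<Delta>_scl \<Delta>X
      by (simp add: A.X_def \<Delta>_add \<Delta>_scl \<Delta>_u \<Delta>_y \<tau>_expand algebra_simps)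
    have "of_nat (Suc n) *\<^sub>C \<Delta> (f (Suc n) a b)
        = \<Delta> (f n n (b - 1)) * \<Delta> ?p + \<Delta> (f n n b) * \<Delta> (A.W ?\<alpha> (A.wt n b))"
      by (simp only: a A.matrix_elem_raise \<Delta>_scl[symmetric] \<Delta>_add \<Delta>_mult)
    also have "\<dots> = (\<Sum>k\<le>Suc n. fact_pair (Suc n) k *\<^sub>C
       \<tau> (f n n (int k - 1) * ?p + f n n (int k) * (?q - A.wt n (int k) *\<^sub>C ?p)) (f (Suc n) k b))"
      unfolding Suc.IH[OF order_refl] \<Delta>X \<Delta>W by (rule tensor_step)
    also have "\<dots> = of_nat (Suc n) *\<^sub>C (\<Sum>k\<le>Suc n. fact_pair (Suc n) k *\<^sub>C \<tau> (f (Suc n) a (int k)) (f (Suc n) k b))"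
      unfolding complex_alg.scale_sum_right W[symmetric] A.matrix_elem_raise[symmetric] a
      by (simp only: \<tau>_scl_left scl_scl mult.commute)
    finally have "inverse (of_nat (Suc n)) *\<^sub>C of_nat (Suc n) *\<^sub>C \<Delta> (f (Suc n) a b)
      = inverse (of_nat (Suc n)) *\<^sub>C of_nat (Suc n) *\<^sub>C (\<Sum>k\<le>Suc n. fact_pair (Suc n) k *\<^sub>C \<tau> (f (Suc n) a (int k)) (f (Suc n) k b))"
      by (rule arg_cong)
    moreover have "inverse (of_nat (Suc n)) * of_nat (Suc n) = (1::complex)"
      by (simp del: of_nat_Suc)
    ultimately show ?thesis by (simp only: scl_scl scl_one)
  qed
qed

end

section \<open>Counit\<close>

locale jordanian_counit = jordanian_matrix h x y u v
  for h and x y u v :: "'a::complex_alg" +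
  fixes \<epsilon> :: "'a \<Rightarrow> complex"
  assumes \<epsilon>_add: "\<epsilon> (a + b) = \<epsilon> a + \<epsilon> b"
    and \<epsilon>_scl: "\<epsilon> (c *\<^sub>C a) = c * \<epsilon> a"
    and \<epsilon>_mult: "\<epsilon> (a * b) = \<epsilon> a * \<epsilon> b"
    and \<epsilon>_1: "\<epsilon> 1 = 1"
    and \<epsilon>_x: "\<epsilon> x = 1" and \<epsilon>_y: "\<epsilon> y = 1" and \<epsilon>_u: "\<epsilon> u = 0" and \<epsilon>_v: "\<epsilon> v = 0"
begin

lemma \<epsilon>_diff: "\<epsilon> (a - b) = \<epsilon> a - \<epsilon> b"
  using \<epsilon>_add[of "a - b" b] by (simp add: algebra_simps)

lemma \<epsilon>_oprod: "\<epsilon> (oprod F n) = (\<Prod>i<n. \<epsilon> (F i))"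
  by (induction n) (simp_all add: \<epsilon>_1 \<epsilon>_mult)

lemma \<epsilon>_term1: "\<epsilon> (term1 K L M N) = (if L = 0 \<and> M = 0 then 1 else 0)"
proof -
  have "\<epsilon> (v ^ L) = 0 ^ L"
    by (induction L) (simp_all add: \<epsilon>_1 \<epsilon>_mult \<epsilon>_v)
  moreover have "(\<Prod>i<M. 2 * (h * of_nat i)) = (if M = 0 then 1 else 0)"
    by (auto simp: prod_zero_iff intro!: bexI[of _ 0])
  ultimately show ?thesis
    unfolding term1_eq_term2 term2_def
    by (simp add: \<epsilon>_mult \<epsilon>_oprod X_def Y_def W_def \<epsilon>_diff \<epsilon>_add \<epsilon>_scl \<epsilon>_x \<epsilon>_y \<epsilon>_u \<epsilon>_v power_0_left)
qed

lemma counit_matrix_elem: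
  assumes "a \<le> n"
  shows "\<epsilon> (matrix_elem n a b) = (if int a = b then 1 / (fact a * fact (n - a)) else 0)"
proof -
  have "\<epsilon> 0 = 0"
    using \<epsilon>_diff[of 0 0] by simp
  then have \<epsilon>_sum: "\<epsilon> (sum g S) = (\<Sum>p\<in>S. \<epsilon> (g p))" for g :: "nat \<times> nat \<times> nat \<times> nat \<Rightarrow> 'a" and S
    by (induction S rule: infinite_finite_induct) (simp_all add: \<epsilon>_add)
  have "\<epsilon> (matrix_elem n a b) = (\<Sum>p\<in>exponents n a b. if p = (a, 0, 0, n - a) then exp_weight p else 0)"
    unfolding matrix_elem_def \<epsilon>_sum
    by (rule sum.cong) (auto simp: \<epsilon>_scl \<epsilon>_term1 exponents_def split: if_splits)
  also have "\<dots> = (if (a, 0, 0, n - a) \<in> exponents n a b then exp_weight (a, 0, 0, n - a) else 0)"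
    by (simp add: finite_exponents)
  also have "(a, 0, 0, n - a) \<in> exponents n a b \<longleftrightarrow> int a = b"
    using assms by (auto simp: exponents_def)
  finally show ?thesis
    by (simp add: exp_weight_def)
qed

end

section \<open>Algebra records and their homomorphisms\<close>

locale assoc_algebra = ring A for A :: "(complex, 'a) module" (structure) +
  assumes smult_closed [simp, intro]: "a \<in> carrier A \<Longrightarrow> c \<odot> a \<in> carrier A"
    and smult_l_distr: "a \<in> carrier A \<Longrightarrow> (c + d) \<odot> a = c \<odot> a \<oplus> d \<odot> a"
    and smult_r_distr: "a \<in> carrier A \<Longrightarrow> b \<in> carrier A \<Longrightarrow> c \<odot> (a \<oplus> b) = c \<odot> a \<oplus> c \<odot> b"
    and smult_assoc: "a \<in> carrier A \<Longrightarrow> c \<odot> (d \<odot> a) = (c * d) \<odot> a"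
    and smult_one: "a \<in> carrier A \<Longrightarrow> 1 \<odot> a = a"
    and smult_mult_left: "a \<in> carrier A \<Longrightarrow> b \<in> carrier A \<Longrightarrow> (c \<odot> a) \<otimes> b = c \<odot> (a \<otimes> b)"
    and smult_mult_right: "a \<in> carrier A \<Longrightarrow> b \<in> carrier A \<Longrightarrow> a \<otimes> (c \<odot> b) = c \<odot> (a \<otimes> b)"

locale assoc_algebra_hom = A: assoc_algebra A + B: assoc_algebra B
  for A :: "(complex, 'a) module" and B :: "(complex, 'b) module" +
  fixes \<phi> :: "'a \<Rightarrow> 'b"
  assumes hom_closed: "a \<in> carrier A \<Longrightarrow> \<phi> a \<in> carrier B"
    and hom_add: "a \<in> carrier A \<Longrightarrow> b \<in> carrier A \<Longrightarrow> \<phi> (a \<oplus>\<^bsub>A\<^esub> b) = \<phi> a \<oplus>\<^bsub>B\<^esub> \<phi> b"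
    and hom_mult: "a \<in> carrier A \<Longrightarrow> b \<in> carrier A \<Longrightarrow> \<phi> (a \<otimes>\<^bsub>A\<^esub> b) = \<phi> a \<otimes>\<^bsub>B\<^esub> \<phi> b"
    and hom_one: "\<phi> \<one>\<^bsub>A\<^esub> = \<one>\<^bsub>B\<^esub>"
    and hom_smult: "a \<in> carrier A \<Longrightarrow> \<phi> (c \<odot>\<^bsub>A\<^esub> a) = c \<odot>\<^bsub>B\<^esub> \<phi> a"

lemma (in assoc_algebra_hom) hom_minus:
  assumes "a \<in> carrier A" "b \<in> carrier A"
  shows "\<phi> (a \<ominus>\<^bsub>A\<^esub> b) = \<phi> a \<ominus>\<^bsub>B\<^esub> \<phi> b"
proof -
  have cancel: "(p \<oplus>\<^bsub>B\<^esub> q) \<ominus>\<^bsub>B\<^esub> q = p" if "p \<in> carrier B" "q \<in> carrier B" for p q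
    using that by (simp add: B.minus_eq B.a_assoc B.r_neg)
  have "\<phi> (a \<ominus>\<^bsub>A\<^esub> b) \<oplus>\<^bsub>B\<^esub> \<phi> b = \<phi> a"
    using assms by (simp add: hom_add[symmetric] A.minus_eq A.a_assoc A.l_neg)
  with cancel[of "\<phi> (a \<ominus>\<^bsub>A\<^esub> b)" "\<phi> b"] assms show ?thesis
    by (simp add: hom_closed)
qed

lemma complex_algebra: "assoc_algebra complex_algebra"
proof -
  have "ring complex_algebra"
    by (rule ringI, rule abelian_groupI) (auto simp: complex_algebra_def algebra_simps
      intro!: monoidI exI[of _ "- _"] simp: eq_neg_iff_add_eq_0 intro: add.left_inverse)
  then show ?thesis
    by (intro assoc_algebra.intro assoc_algebra_axioms.intro) (auto simp: complex_algebra_def algebra_simps)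
qed

section \<open>Monoid algebras\<close>

abbreviation (input) coeff where "coeff \<equiv> Poly_Mapping.lookup"
abbreviation (input) mon where "mon \<equiv> Poly_Mapping.single"

lemma sum_singles: "(\<Sum>a\<in>Poly_Mapping.keys f. mon a (coeff f a)) = f" for f :: "'a \<Rightarrow>\<^sub>0 complex"
proof (rule poly_mapping_eqI)
  fix k
  show "coeff (\<Sum>a\<in>Poly_Mapping.keys f. mon a (coeff f a)) k = coeff f k"
    by (simp add: lookup_sum lookup_single when_def in_keys_iff)
qed

text \<open>
  The product is defined by sums over the supports of the factors. Summing over larger sets makes
  bilinearity visible, and bilinearity reduces the ring laws to monomials.
\<close>

lemma mult_monoid_algebra_superset:
  assumes "finite S" "Poly_Mapping.keys f \<subseteq> S" "finite T" "Poly_Mapping.keys g \<subseteq> T"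
  shows "f \<otimes>\<^bsub>monoid_algebra G\<^esub> g = (\<Sum>a\<in>S. \<Sum>b\<in>T. mon (a \<otimes>\<^bsub>G\<^esub> b) (coeff f a * coeff g b))"
proof -
  have "(\<Sum>b\<in>Poly_Mapping.keys g. mon (a \<otimes>\<^bsub>G\<^esub> b) (coeff f a * coeff g b))
      = (\<Sum>b\<in>T. mon (a \<otimes>\<^bsub>G\<^esub> b) (coeff f a * coeff g b))" for a
    using assms by (intro sum.mono_neutral_left) (auto simp: in_keys_iff)
  moreover have "(\<Sum>a\<in>Poly_Mapping.keys f. \<Sum>b\<in>T. mon (a \<otimes>\<^bsub>G\<^esub> b) (coeff f a * coeff g b))
      = (\<Sum>a\<in>S. \<Sum>b\<in>T. mon (a \<otimes>\<^bsub>G\<^esub> b) (coeff f a * coeff g b))"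
    using assms by (intro sum.mono_neutral_left) (auto simp: in_keys_iff)
  ultimately show ?thesis
    by (simp add: monoid_algebra_def)
qed

lemma mult_monoid_algebra_add_left:
  "(f + f') \<otimes>\<^bsub>monoid_algebra G\<^esub> g = f \<otimes>\<^bsub>monoid_algebra G\<^esub> g + f' \<otimes>\<^bsub>monoid_algebra G\<^esub> g"
proof -
  let ?S = "Poly_Mapping.keys f \<union> Poly_Mapping.keys f'"
  have "Poly_Mapping.keys (f + f') \<subseteq> ?S" by (rule Poly_Mapping.keys_add)
  then show ?thesis
    by (simp add: mult_monoid_algebra_superset[of ?S _ "Poly_Mapping.keys g"] lookup_add distrib_right
        single_add sum.distrib)
qed

lemma mult_monoid_algebra_add_right:
  "f \<otimes>\<^bsub>monoid_algebra G\<^esub> (g + g') = f \<otimes>\<^bsub>monoid_algebra G\<^esub> g + f \<otimes>\<^bsub>monoid_algebra G\<^esub> g'"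
proof -
  let ?T = "Poly_Mapping.keys g \<union> Poly_Mapping.keys g'"
  have "Poly_Mapping.keys (g + g') \<subseteq> ?T" by (rule Poly_Mapping.keys_add)
  then show ?thesis
    by (simp add: mult_monoid_algebra_superset[of "Poly_Mapping.keys f" _ ?T] lookup_add distrib_left
        single_add sum.distrib)
qed

lemma mult_monoid_algebra_single:
  "mon a c \<otimes>\<^bsub>monoid_algebra G\<^esub> mon b d = mon (a \<otimes>\<^bsub>G\<^esub> b) (c * d)"
  by (subst mult_monoid_algebra_superset[of "{a}" _ "{b}"]) auto

lemma mult_monoid_algebra_zero [simp]:
  "0 \<otimes>\<^bsub>monoid_algebra G\<^esub> g = 0" "f \<otimes>\<^bsub>monoid_algebra G\<^esub> 0 = 0"
  by (simp_all add: monoid_algebra_def)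

lemma monoid_algebra_induct [consumes 1, case_names single add]:
  fixes f :: "'a \<Rightarrow>\<^sub>0 complex"
  assumes "Poly_Mapping.keys f \<subseteq> S"
    and "\<And>a c. a \<in> S \<Longrightarrow> P (mon a c)" and "\<And>f g. P f \<Longrightarrow> P g \<Longrightarrow> P (f + g)" and "P 0"
  shows "P f"
proof -
  have "P (\<Sum>a\<in>K. mon a (coeff f a))" if "finite K" "K \<subseteq> S" for K
    using that by (induction K) (auto intro: assms)
  from this[of "Poly_Mapping.keys f"] show ?thesis
    using assms(1) by (simp add: sum_singles)
qed

lemma lookup_map_times: "coeff (Poly_Mapping.map ((*) (c::complex)) f) a = c * coeff f a"
  by (simp add: Poly_Mapping.map.rep_eq when_def)

lemma carrier_monoid_algebra: "f \<in> carrier (monoid_algebra G) \<longleftrightarrow> Poly_Mapping.keys f \<subseteq> carrier G"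
  by (simp add: monoid_algebra_def)

lemma monoid_algebra_simps:
  "\<zero>\<^bsub>monoid_algebra G\<^esub> = 0" "f \<oplus>\<^bsub>monoid_algebra G\<^esub> g = f + g" "\<one>\<^bsub>monoid_algebra G\<^esub> = mon \<one>\<^bsub>G\<^esub> 1"
  "c \<odot>\<^bsub>monoid_algebra G\<^esub> f = Poly_Mapping.map ((*) c) f"
  by (simp_all add: monoid_algebra_def)

lemma map_times_mult:
  "Poly_Mapping.map ((*) c) f \<otimes>\<^bsub>monoid_algebra G\<^esub> g = Poly_Mapping.map ((*) c) (f \<otimes>\<^bsub>monoid_algebra G\<^esub> g)"
  "f \<otimes>\<^bsub>monoid_algebra G\<^esub> Poly_Mapping.map ((*) c) g = Poly_Mapping.map ((*) c) (f \<otimes>\<^bsub>monoid_algebra G\<^esub> g)"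
proof -
  have keys: "Poly_Mapping.keys (Poly_Mapping.map ((*) c) f) \<subseteq> Poly_Mapping.keys f" for f :: "'a \<Rightarrow>\<^sub>0 complex"
    by (auto simp: in_keys_iff lookup_map_times)
  have map_sum: "Poly_Mapping.map ((*) c) (sum F I) = (\<Sum>i\<in>I. Poly_Mapping.map ((*) c) (F i))"
    for F :: "'i \<Rightarrow> 'a \<Rightarrow>\<^sub>0 complex" and I
    by (rule poly_mapping_eqI) (simp add: lookup_map_times lookup_sum sum_distrib_left)
  have map_single: "Poly_Mapping.map ((*) c) (mon a d) = mon a (c * d)" for a :: 'a and d
    by (rule poly_mapping_eqI) (simp add: lookup_map_times lookup_single when_def)
  show "Poly_Mapping.map ((*) c) f \<otimes>\<^bsub>monoid_algebra G\<^esub> g = Poly_Mapping.map ((*) c) (f \<otimes>\<^bsub>monoid_algebra G\<^esub> g)"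
    by (simp add: mult_monoid_algebra_superset[of "Poly_Mapping.keys f" _ "Poly_Mapping.keys g"] keys map_sum map_single
       lookup_map_times mult_ac)
  show "f \<otimes>\<^bsub>monoid_algebra G\<^esub> Poly_Mapping.map ((*) c) g = Poly_Mapping.map ((*) c) (f \<otimes>\<^bsub>monoid_algebra G\<^esub> g)"
    by (simp add: mult_monoid_algebra_superset[of "Poly_Mapping.keys f" _ "Poly_Mapping.keys g"] keys map_sum map_single
       lookup_map_times mult_ac)
qed

lemma monoid_algebra:
  assumes "monoid G"
  shows "assoc_algebra (monoid_algebra G)"
proof -
  interpret G: monoid G by fact
  let ?A = "monoid_algebra G"
  note simps = carrier_monoid_algebra monoid_algebra_simps
  have closed: "f \<otimes>\<^bsub>?A\<^esub> g \<in> carrier ?A" if f: "f \<in> carrier ?A" and g: "g \<in> carrier ?A" for f g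
  proof -
    have "Poly_Mapping.keys (mon (a \<otimes>\<^bsub>G\<^esub> b) c) \<subseteq> carrier G"
      if "a \<in> Poly_Mapping.keys f" "b \<in> Poly_Mapping.keys g" for a b and c :: complex
    proof -
      have "a \<in> carrier G" "b \<in> carrier G"
        using that f g by (auto simp: carrier_monoid_algebra)
      then show ?thesis by simp
    qed
    then have "Poly_Mapping.keys (\<Sum>a\<in>Poly_Mapping.keys f. \<Sum>b\<in>Poly_Mapping.keys g. mon (a \<otimes>\<^bsub>G\<^esub> b) (coeff f a * coeff g b)) \<subseteq> carrier G"
      by (intro order_trans[OF Poly_Mapping.keys_sum] UN_least)
    then show ?thesis by (simp add: monoid_algebra_def)
  qed
  have assoc: "(f \<otimes>\<^bsub>?A\<^esub> g) \<otimes>\<^bsub>?A\<^esub> k = f \<otimes>\<^bsub>?A\<^esub> (g \<otimes>\<^bsub>?A\<^esub> k)"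
    if "f \<in> carrier ?A" "g \<in> carrier ?A" "k \<in> carrier ?A" for f g k
    using that(1)[unfolded simps]
  proof (induction rule: monoid_algebra_induct)
    case (single a c)
    show ?case using that(2)[unfolded simps]
    proof (induction rule: monoid_algebra_induct)
      case b: (single b d)
      show ?case using that(3)[unfolded simps]
      proof (induction rule: monoid_algebra_induct)
        case (single e r)
        then show ?case using \<open>a \<in> carrier G\<close> b
          by (simp add: mult_monoid_algebra_single G.m_assoc mult.assoc)
      qed (simp_all add: mult_monoid_algebra_add_right)
    qed (simp_all add: mult_monoid_algebra_add_right mult_monoid_algebra_add_left)
  qed (simp_all add: mult_monoid_algebra_add_left)
  have unit: "mon \<one>\<^bsub>G\<^esub> 1 \<otimes>\<^bsub>?A\<^esub> f = f" "f \<otimes>\<^bsub>?A\<^esub> mon \<one>\<^bsub>G\<^esub> 1 = f" if "f \<in> carrier ?A" for f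
    using that[unfolded simps]
    by (induction rule: monoid_algebra_induct)
      (simp_all add: mult_monoid_algebra_add_left mult_monoid_algebra_add_right mult_monoid_algebra_single)
  have keys_add: "Poly_Mapping.keys (f + g) \<subseteq> carrier G"
    if "Poly_Mapping.keys f \<subseteq> carrier G" "Poly_Mapping.keys g \<subseteq> carrier G" for f g :: "'a \<Rightarrow>\<^sub>0 complex"
    using that Poly_Mapping.keys_add[of f g] by blast
  have "ring ?A"
  proof (rule ringI)
    show "abelian_group ?A"
    proof (rule abelian_groupI)
      show "\<exists>g\<in>carrier ?A. g \<oplus>\<^bsub>?A\<^esub> f = \<zero>\<^bsub>?A\<^esub>" if "f \<in> carrier ?A" for f
        using that by (intro bexI[of _ "- f"]) (simp_all add: simps)
    qed (auto simp: simps keys_add ac_simps)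
    show "Group.monoid ?A"
      by (rule monoidI) (simp_all add: closed assoc unit monoid_algebra_simps, simp add: carrier_monoid_algebra)
  qed (simp_all add: monoid_algebra_simps mult_monoid_algebra_add_left mult_monoid_algebra_add_right)
  moreover have "Poly_Mapping.keys (Poly_Mapping.map ((*) c) f) \<subseteq> carrier G"
    if "Poly_Mapping.keys f \<subseteq> carrier G" for f and c :: complex
    using that by (auto simp: in_keys_iff lookup_map_times)
  ultimately show ?thesis
    by (intro assoc_algebra.intro assoc_algebra_axioms.intro)
      (auto simp: simps map_times_mult intro!: poly_mapping_eqI simp: lookup_map_times lookup_add algebra_simps)
qed

section \<open>Quotients by relations\<close>

lemma quotient_algebra_simps:
  "carrier (quotient_algebra A I) = a_rcosets\<^bsub>A\<^esub> I"
  "\<zero>\<^bsub>quotient_algebra A I\<^esub> = I" "\<one>\<^bsub>quotient_algebra A I\<^esub> = I +>\<^bsub>A\<^esub> \<one>\<^bsub>A\<^esub>"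
  "C \<oplus>\<^bsub>quotient_algebra A I\<^esub> C' = C <+>\<^bsub>A\<^esub> C'"
  "C \<otimes>\<^bsub>quotient_algebra A I\<^esub> C' = rcoset_mult A I C C'"
  "c \<odot>\<^bsub>quotient_algebra A I\<^esub> C = (\<Union>a\<in>C. I +>\<^bsub>A\<^esub> (c \<odot>\<^bsub>A\<^esub> a))"
  by (simp_all add: quotient_algebra_def FactRing_def ring.extend_def module.fields_def)

locale algebra_ideal = assoc_algebra A + ideal I A for A :: "(complex, 'a) module" (structure) and I
begin

abbreviation Q where "Q \<equiv> quotient_algebra A I"

lemma coset_cong:
  assumes "a \<in> carrier A" "b \<in> carrier A" "a \<ominus> b \<in> I"
  shows "I +> a = I +> b"
proof -
  have "a \<in> I +> b"
    using a_rcos_module_rev assms by (auto simp: a_minus_def)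
  with assms show ?thesis
    using a_repr_independence[of a I b] a_subgroup by simp
qed

lemma cosetD:
  assumes "a \<in> carrier A" "a' \<in> I +> a"
  shows "\<exists>i\<in>I. a' = i \<oplus> a"
  using assms by (auto simp: a_r_coset_def')

lemma smult_ideal: "i \<in> I \<Longrightarrow> c \<odot> i \<in> I"
  using I_l_closed[of i "c \<odot> \<one>"] a_subset smult_mult_left[of \<one> i c] by auto

lemma Q_carrier: "C \<in> carrier Q \<longleftrightarrow> (\<exists>a\<in>carrier A. C = I +> a)"
  by (auto simp: quotient_algebra_simps A_RCOSETS_def')

lemma Q_I: "a \<in> carrier A \<Longrightarrow> I +> a \<in> carrier Q"
  by (auto simp: Q_carrier)

lemma Q_E:
  assumes "C \<in> carrier Q"
  obtains a where "a \<in> carrier A" "C = I +> a"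
  using assms by (auto simp: Q_carrier)

lemma Q_add: "a \<in> carrier A \<Longrightarrow> b \<in> carrier A \<Longrightarrow> (I +> a) \<oplus>\<^bsub>Q\<^esub> (I +> b) = I +> (a \<oplus> b)"
  by (simp add: quotient_algebra_simps a_rcos_sum)

lemma Q_mult: "a \<in> carrier A \<Longrightarrow> b \<in> carrier A \<Longrightarrow> (I +> a) \<otimes>\<^bsub>Q\<^esub> (I +> b) = I +> (a \<otimes> b)"
  by (simp add: quotient_algebra_simps rcoset_mult_add)

lemma Q_zero: "\<zero>\<^bsub>Q\<^esub> = I +> \<zero>"
  by (simp only: quotient_algebra_simps a_coset_add_zero[OF a_subset])

lemma Q_one: "\<one>\<^bsub>Q\<^esub> = I +> \<one>"
  by (simp add: quotient_algebra_simps)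

lemma Q_smult:
  assumes a: "a \<in> carrier A"
  shows "c \<odot>\<^bsub>Q\<^esub> (I +> a) = I +> (c \<odot> a)"
proof -
  have "I +> (c \<odot> a') = I +> (c \<odot> a)" if a': "a' \<in> I +> a" for a'
  proof -
    obtain i where i: "i \<in> I" "a' = i \<oplus> a" using cosetD[OF a a'] by blast
    have ic: "i \<in> carrier A" using i a_subset by blast
    have "c \<odot> a' \<ominus> c \<odot> a = c \<odot> i"
      using a ic by (simp add: i smult_r_distr a_minus_def a_assoc r_neg)
    then show ?thesis
      using a ic i by (intro coset_cong) (auto simp: smult_ideal)
  qed
  moreover have "a \<in> I +> a" using a a_rcos_self by blast
  ultimately show ?thesis
    unfolding quotient_algebra_simps by blast
qed

lemma assoc_algebra_Q: "assoc_algebra Q"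
proof -
  note simps = Q_add Q_mult Q_zero Q_one Q_smult
  have "ring Q"
  proof (rule ringI)
    show "abelian_group Q"
    proof (rule abelian_groupI)
      show "\<exists>D\<in>carrier Q. D \<oplus>\<^bsub>Q\<^esub> C = \<zero>\<^bsub>Q\<^esub>" if C: "C \<in> carrier Q" for C
      proof -
        obtain a where a: "a \<in> carrier A" "C = I +> a" using C by (auto simp: Q_carrier)
        then have "(I +> (\<ominus> a)) \<oplus>\<^bsub>Q\<^esub> C = \<zero>\<^bsub>Q\<^esub>" by (simp add: simps l_neg)
        moreover have "I +> (\<ominus> a) \<in> carrier Q" using a by (auto simp: Q_carrier)
        ultimately show ?thesis by blast
      qed
    next
      show "C \<oplus>\<^bsub>Q\<^esub> D \<oplus>\<^bsub>Q\<^esub> E = C \<oplus>\<^bsub>Q\<^esub> (D \<oplus>\<^bsub>Q\<^esub> E)"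
        if "C \<in> carrier Q" "D \<in> carrier Q" "E \<in> carrier Q" for C D E
        using that by (auto simp: Q_carrier simps a_assoc)
      show "C \<oplus>\<^bsub>Q\<^esub> D = D \<oplus>\<^bsub>Q\<^esub> C" if CD: "C \<in> carrier Q" "D \<in> carrier Q" for C D
      proof -
        obtain a b where ab: "a \<in> carrier A" "C = I +> a" "b \<in> carrier A" "D = I +> b"
          using CD by (auto simp: Q_carrier)
        then show ?thesis by (simp add: simps a_comm[of a b])
      qed
      show "\<zero>\<^bsub>Q\<^esub> \<oplus>\<^bsub>Q\<^esub> C = C" if C: "C \<in> carrier Q" for C
      proof -
        obtain a where "a \<in> carrier A" "C = I +> a" using C by (auto simp: Q_carrier)
        then show ?thesis unfolding Q_zero using Q_add[of \<zero> a] by (simp del: a_coset_add_zero)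
      qed
    qed (auto elim!: Q_E intro!: Q_I simp: Q_add Q_zero)
    show "Group.monoid Q"
      by (rule monoidI) (auto elim!: Q_E intro!: Q_I simp: simps m_assoc)
  qed (auto elim!: Q_E intro!: Q_I simp: simps l_distr r_distr)
  then show ?thesis
    by (intro assoc_algebra.intro assoc_algebra_axioms.intro)
      (auto elim!: Q_E intro!: Q_I simp: simps smult_l_distr smult_r_distr smult_assoc smult_one smult_mult_left smult_mult_right)
qed

lemma proj_hom: "assoc_algebra_hom A Q (\<lambda>a. I +> a)"
proof -
  have "assoc_algebra_hom_axioms A Q (\<lambda>a. I +> a)"
    by unfold_locales (simp_all add: Q_I Q_add Q_mult Q_one Q_smult)
  then show ?thesis
    by (intro assoc_algebra_hom.intro assoc_algebra_Q assoc_algebra_axioms)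
qed

text \<open>
  The universal property of the quotient; it makes the value of \<open>quotient_lift\<close> independent of the
  chosen representative.
\<close>

lemma quotient_lift_hom:
  assumes "assoc_algebra_hom A B \<phi>" and I: "\<And>i. i \<in> I \<Longrightarrow> \<phi> i = \<zero>\<^bsub>B\<^esub>"
  shows "assoc_algebra_hom Q B (quotient_lift \<phi>)"
    and "a \<in> carrier A \<Longrightarrow> quotient_lift \<phi> (I +> a) = \<phi> a"
proof -
  interpret \<phi>: assoc_algebra_hom A B \<phi> by fact
  have lift: "quotient_lift \<phi> (I +> a) = \<phi> a" if a: "a \<in> carrier A" for a
  proof -
    have "\<phi> a' = \<phi> a" if a': "a' \<in> I +> a" for a'
    proof -
      obtain i where i: "i \<in> I" "a' = i \<oplus> a" using cosetD[OF a a'] by blast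
      moreover have "i \<in> carrier A" using i a_subset by blast
      ultimately show ?thesis using a I[of i] by (simp add: \<phi>.hom_add \<phi>.hom_closed)
    qed
    moreover have "a \<in> I +> a" using a a_rcos_self by blast
    ultimately have "\<phi> ` (I +> a) = {\<phi> a}" by blast
    then show ?thesis by (simp add: quotient_lift_def)
  qed
  then show "a \<in> carrier A \<Longrightarrow> quotient_lift \<phi> (I +> a) = \<phi> a" .
  have "assoc_algebra_hom_axioms Q B (quotient_lift \<phi>)"
    by unfold_locales
      (auto simp: Q_carrier Q_add Q_mult Q_one Q_smult lift \<phi>.hom_closed \<phi>.hom_add \<phi>.hom_mult \<phi>.hom_one \<phi>.hom_smult)
  then show "assoc_algebra_hom Q B (quotient_lift \<phi>)"
    by (intro assoc_algebra_hom.intro assoc_algebra_Q \<phi>.B.assoc_algebra_axioms)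
qed

end

lemma (in assoc_algebra) relation_ideal:
  assumes "R \<subseteq> carrier A \<times> carrier A"
  shows "algebra_ideal A (relation_ideal A R)"
    and "(a, b) \<in> R \<Longrightarrow> relation_ideal A R +> a = relation_ideal A R +> b"
proof -
  have sub: "{a \<ominus> b | a b. (a, b) \<in> R} \<subseteq> carrier A"
    using assms by auto
  show *: "algebra_ideal A (relation_ideal A R)"
    unfolding relation_ideal_def
    by (intro algebra_ideal.intro genideal_ideal[OF sub]) unfold_locales
  show "relation_ideal A R +> a = relation_ideal A R +> b" if "(a, b) \<in> R"
    using assms that genideal_self[OF sub]
    by (intro algebra_ideal.coset_cong[OF *]) (auto simp: relation_ideal_def)
qed

lemma (in assoc_algebra_hom) hom_relation_ideal:
  assumes R: "R \<subseteq> carrier A \<times> carrier A" and eq: "\<And>a b. (a, b) \<in> R \<Longrightarrow> \<phi> a = \<phi> b"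
    and i: "i \<in> relation_ideal A R"
  shows "\<phi> i = \<zero>\<^bsub>B\<^esub>"
proof -
  have hom: "ring_hom_ring A B \<phi>"
    by (intro ring_hom_ringI2 A.ring_axioms B.ring_axioms ring_hom_memI)
      (simp_all add: hom_closed hom_mult hom_add hom_one)
  have "{a \<ominus>\<^bsub>A\<^esub> b | a b. (a, b) \<in> R} \<subseteq> a_kernel A B \<phi>"
  proof clarify
    fix a b assume ab: "(a, b) \<in> R"
    then have carr: "a \<in> carrier A" "b \<in> carrier A" using R by auto
    then have "\<phi> (a \<ominus>\<^bsub>A\<^esub> b) = \<zero>\<^bsub>B\<^esub>"
      using hom_minus[OF carr] eq[OF ab] hom_closed[OF carr(2)] by (simp add: B.minus_eq B.r_neg)
    then show "a \<ominus>\<^bsub>A\<^esub> b \<in> a_kernel A B \<phi>"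
      using carr by (simp add: a_kernel_def')
  qed
  then have "relation_ideal A R \<subseteq> a_kernel A B \<phi>"
    unfolding relation_ideal_def by (rule A.genideal_minimal[OF ring_hom_ring.kernel_is_ideal[OF hom]])
  with i show ?thesis by (auto simp: a_kernel_def')
qed

section \<open>Families of elements of all algebras\<close>

lemma assoc_algebra_ring: "assoc_algebra A \<Longrightarrow> ring A"
  by (rule assoc_algebra.axioms)

lemma (in assoc_algebra) smult_zero: "c \<odot> \<zero> = \<zero>"
  using smult_mult_right[of \<zero> \<zero> c] by simp

lemma (in assoc_algebra) zero_mult: "\<zero> \<otimes> \<zero> = \<zero>"
  by simp

text \<open>
  An element of this type chooses an element of every algebra whose carrier has elements of type
  \<open>'a\<close>, so the type is the product of all these algebras. It is a complex algebra in the sense of the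
  type class, and \<open>component A\<close> projects it onto \<open>A\<close>. An identity proved in the class for suitable
  families thus yields an identity in the carrier of \<open>A\<close>. Records that are not algebras get the value
  \<open>undefined\<close>, which makes a family determined by its components.
\<close>

typedef 'a family = "{f :: (complex, 'a) module \<Rightarrow> 'a.
    \<forall>A. if assoc_algebra A then f A \<in> carrier A else f A = undefined}"
  by (rule exI[of _ "\<lambda>A. if assoc_algebra A then \<zero>\<^bsub>A\<^esub> else undefined"])
    (simp add: assoc_algebra_ring ring.ring_simprules)

definition component :: "(complex, 'a) module \<Rightarrow> 'a family \<Rightarrow> 'a" where
  "component A f = Rep_family f A"

definition family :: "((complex, 'a) module \<Rightarrow> 'a) \<Rightarrow> 'a family" where
  "family F = Abs_family (\<lambda>A. if assoc_algebra A then F A else undefined)"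

lemma component_closed: "assoc_algebra A \<Longrightarrow> component A f \<in> carrier A"
  using Rep_family[of f] by (auto simp: component_def split: if_splits)

lemma component_family:
  assumes "\<And>A. assoc_algebra A \<Longrightarrow> F A \<in> carrier A" and "assoc_algebra A"
  shows "component A (family F) = F A"
  using assms by (simp add: component_def family_def Abs_family_inverse)

lemma family_eqI:
  assumes "\<And>A. assoc_algebra A \<Longrightarrow> component A f = component A g"
  shows "f = g"
proof -
  have "Rep_family f A = Rep_family g A" for A
    using assms[of A] Rep_family[of f] Rep_family[of g] by (cases "assoc_algebra A") (auto simp: component_def)
  then show ?thesis
    by (simp add: Rep_family_inject[symmetric] ext)
qed

instantiation family :: (type) complex_alg
begin

definition "0 = family (\<lambda>A. \<zero>\<^bsub>A\<^esub>)"
definition "1 = family (\<lambda>A. \<one>\<^bsub>A\<^esub>)"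
definition "f + g = family (\<lambda>A. component A f \<oplus>\<^bsub>A\<^esub> component A g)"
definition "- f = family (\<lambda>A. \<ominus>\<^bsub>A\<^esub> component A f)"
definition "f - g = family (\<lambda>A. component A f \<ominus>\<^bsub>A\<^esub> component A g)"
definition "f * g = family (\<lambda>A. component A f \<otimes>\<^bsub>A\<^esub> component A g)"
definition "c *\<^sub>C f = family (\<lambda>A. c \<odot>\<^bsub>A\<^esub> component A f)"

lemma component_hom:
  assumes A: "assoc_algebra A"
  shows "component A 0 = \<zero>\<^bsub>A\<^esub>" "component A 1 = \<one>\<^bsub>A\<^esub>"
    "component A (f + g) = component A f \<oplus>\<^bsub>A\<^esub> component A g"
    "component A (- f) = \<ominus>\<^bsub>A\<^esub> component A f" "component A (f - g) = component A f \<ominus>\<^bsub>A\<^esub> component A g"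
    "component A (f * g) = component A f \<otimes>\<^bsub>A\<^esub> component A g"
    "component A (c *\<^sub>C f) = c \<odot>\<^bsub>A\<^esub> component A f"
  unfolding zero_family_def one_family_def plus_family_def uminus_family_def minus_family_def
    times_family_def scl_family_def
  by (rule component_family[OF _ A],
      simp add: component_closed assoc_algebra_ring ring.ring_simprules assoc_algebra.smult_closed)+

instance
proof
  fix f g k :: "'a family" and c d :: complex
  note facts = component_hom component_closed assoc_algebra_ring
  note ring = ring.ring_simprules monoid.m_assoc
  show "f + g + k = f + (g + k)" by (rule family_eqI) (simp add: facts ring)
  show "f + g = g + f" by (rule family_eqI) (simp add: facts ring)
  show "0 + f = f" by (rule family_eqI) (simp add: facts ring)
  show "- f + f = 0" by (rule family_eqI) (simp add: facts ring.ring_simprules(9))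
  show "f - g = f + - g" by (rule family_eqI) (simp add: facts a_minus_def)
  show "f * g * k = f * (g * k)" by (rule family_eqI) (simp add: facts ring)
  show "1 * f = f" by (rule family_eqI) (simp add: facts ring)
  show "f * 1 = f" by (rule family_eqI) (simp add: facts monoid.r_one ring.axioms(2))
  show "(f + g) * k = f * k + g * k" by (rule family_eqI) (simp add: facts ring)
  show "f * (g + k) = f * g + f * k" by (rule family_eqI) (simp add: facts ring)
  show "c *\<^sub>C (f + g) = c *\<^sub>C f + c *\<^sub>C g"
    by (rule family_eqI) (simp add: facts assoc_algebra.smult_r_distr)
  show "(c + d) *\<^sub>C f = c *\<^sub>C f + d *\<^sub>C f"
    by (rule family_eqI) (simp add: facts assoc_algebra.smult_l_distr)
  show "c *\<^sub>C d *\<^sub>C f = (c * d) *\<^sub>C f"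
    by (rule family_eqI) (simp add: facts assoc_algebra.smult_assoc)
  show "1 *\<^sub>C f = f"
    by (rule family_eqI) (simp add: facts assoc_algebra.smult_one)
  show "(c *\<^sub>C f) * g = c *\<^sub>C (f * g)"
    by (rule family_eqI) (simp add: facts assoc_algebra.smult_mult_left)
  show "f * (c *\<^sub>C g) = c *\<^sub>C (f * g)"
    by (rule family_eqI) (simp add: facts assoc_algebra.smult_mult_right)
qed

end

text \<open>
  A section of \<open>component A\<close> that respects all operations but the unit. The components elsewhere
  are \<open>0\<close>, where relations without constant term hold trivially; hence such relations between elements of \<open>A\<close> become
  relations between families.
\<close>

definition embed :: "(complex, 'a) module \<Rightarrow> 'a \<Rightarrow> 'a family" where
  "embed A a = family (\<lambda>B. if B = A then a else \<zero>\<^bsub>B\<^esub>)"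

context assoc_algebra
begin

lemmas component = component_hom[OF assoc_algebra_axioms]

lemma component_embed: "a \<in> carrier A \<Longrightarrow> component A (embed A a) = a"
  unfolding embed_def
  by (subst component_family) (auto simp: assoc_algebra_axioms assoc_algebra_ring ring.ring_simprules)

lemma component_embed_other:
  "a \<in> carrier A \<Longrightarrow> B \<noteq> A \<Longrightarrow> assoc_algebra B \<Longrightarrow> component B (embed A a) = \<zero>\<^bsub>B\<^esub>"
  unfolding embed_def
  by (subst component_family) (auto simp: assoc_algebra_axioms assoc_algebra_ring ring.ring_simprules)

lemma embed_eqI:
  assumes "a \<in> carrier A" "component A f = a"
    and "\<And>B. B \<noteq> A \<Longrightarrow> assoc_algebra B \<Longrightarrow> component B f = \<zero>\<^bsub>B\<^esub>"
  shows "embed A a = f"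
  using assms by (intro family_eqI) (metis component_embed component_embed_other)

lemma embed_add: "a \<in> carrier A \<Longrightarrow> b \<in> carrier A \<Longrightarrow> embed A (a \<oplus> b) = embed A a + embed A b"
  by (rule embed_eqI) (simp_all add: component_hom component_embed component_embed_other assoc_algebra_axioms
      assoc_algebra_ring ring.ring_simprules)

lemma embed_mult: "a \<in> carrier A \<Longrightarrow> b \<in> carrier A \<Longrightarrow> embed A (a \<otimes> b) = embed A a * embed A b"
  by (rule embed_eqI) (simp_all add: component_hom component_embed component_embed_other assoc_algebra_axioms
      assoc_algebra_ring ring.ring_simprules assoc_algebra.zero_mult)

lemma embed_smult: "a \<in> carrier A \<Longrightarrow> embed A (c \<odot> a) = c *\<^sub>C embed A a"
  by (rule embed_eqI) (simp_all add: component_hom component_embed component_embed_other assoc_algebra_axioms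
      assoc_algebra.smult_zero)

lemma embed_minus: "a \<in> carrier A \<Longrightarrow> b \<in> carrier A \<Longrightarrow> embed A (a \<ominus> b) = embed A a - embed A b"
  by (rule embed_eqI) (simp_all add: component_hom component_embed component_embed_other assoc_algebra_axioms
      assoc_algebra_ring ring.ring_simprules)

lemma component_sum:
  assumes "finite S"
  shows "component A (sum f S) = (\<Oplus>i\<in>S. component A (f i))"
  using assms
  by (induction S) (simp_all add: component component_closed assoc_algebra_axioms)

lemma component_power: "component A (f ^ n) = component A f [^] n"
  by (induction n) (simp_all add: component power_Suc2 del: power_Suc)

lemma component_oprod: "component A (oprod F n) = ordered_prod A (\<lambda>i. component A (F i)) n"
proof -
  have "component A (prod_list (map F is)) = foldr (\<lambda>i p. component A (F i) \<otimes> p) is \<one>" for "is"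
    by (induction "is") (simp_all add: component)
  then show ?thesis by (simp add: ordered_prod_def)
qed

end

section \<open>Free algebras\<close>

lemma free_algebra: "assoc_algebra free_algebra"
  unfolding free_algebra_def
  by (rule monoid_algebra, rule monoidI) (simp_all add: word_monoid_def)

lemma carrier_free_algebra [simp]: "f \<in> carrier free_algebra"
  by (simp add: free_algebra_def carrier_monoid_algebra word_monoid_def)

lemma free_algebra_simps:
  "f \<oplus>\<^bsub>free_algebra\<^esub> g = f + g" "\<one>\<^bsub>free_algebra\<^esub> = Poly_Mapping.single [] 1"
  "c \<odot>\<^bsub>free_algebra\<^esub> f = Poly_Mapping.map ((*) c) f"
  by (simp_all add: free_algebra_def monoid_algebra_simps word_monoid_def)

context assoc_algebra
begin

lemma free_lift_eq_component:
  assumes g: "\<And>s. g s \<in> carrier A"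
  shows "free_lift A g f = component A (\<Sum>w\<in>Poly_Mapping.keys f. Poly_Mapping.lookup f w *\<^sub>C prod_list (map (\<lambda>s. embed A (g s)) w))"
proof -
  have "component A (prod_list (map (\<lambda>s. embed A (g s)) w)) = foldr (\<lambda>s p. g s \<otimes> p) w \<one>" for w
    by (induction w) (simp_all add: component component_embed g)
  then show ?thesis
    by (simp add: free_lift_def component_sum component)
qed

text \<open>
  The universal property of the free algebra. The lift is the projection to \<open>A\<close> of a map into the
  families, for which additivity and multiplicativity are computations with finite sums in the class.
\<close>

lemma free_lift_hom:
  assumes g: "\<And>s. g s \<in> carrier A"
  shows "assoc_algebra_hom free_algebra A (free_lift A g)"
    and "free_lift A g (free_gen s) = g s"
proof -
  define P where "P = (\<lambda>w. prod_list (map (\<lambda>s. embed A (g s)) w))"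
  define \<phi> where "\<phi> = (\<lambda>f. \<Sum>w\<in>Poly_Mapping.keys f. Poly_Mapping.lookup f w *\<^sub>C P w)"
  have lift: "free_lift A g f = component A (\<phi> f)" for f
    unfolding \<phi>_def P_def by (rule free_lift_eq_component[OF g])
  have superset: "\<phi> f = (\<Sum>w\<in>S. Poly_Mapping.lookup f w *\<^sub>C P w)"
    if "finite S" "Poly_Mapping.keys f \<subseteq> S" for f S
    unfolding \<phi>_def using that by (intro sum.mono_neutral_left) (auto simp: in_keys_iff)
  have add: "\<phi> (f + f') = \<phi> f + \<phi> f'" for f f'
  proof -
    let ?S = "Poly_Mapping.keys f \<union> Poly_Mapping.keys f'"
    have "Poly_Mapping.keys (f + f') \<subseteq> ?S" by (rule Poly_Mapping.keys_add)
    then show ?thesis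
      by (simp add: superset[of ?S] lookup_add scl_add_left sum.distrib)
  qed
  have single: "\<phi> (Poly_Mapping.single w c) = c *\<^sub>C P w" for w c
    by (subst superset[of "{w}"]) simp_all
  have mult: "\<phi> (f \<otimes>\<^bsub>free_algebra\<^esub> f') = \<phi> f * \<phi> f'" for f f'
  proof -
    have zero: "\<phi> 0 = 0" by (simp add: \<phi>_def)
    have "Poly_Mapping.keys f \<subseteq> UNIV" by simp
    then show ?thesis
      unfolding free_algebra_def
    proof (induction rule: monoid_algebra_induct)
      case (single a c)
      have "Poly_Mapping.keys f' \<subseteq> UNIV" by simp
      then show ?case
      proof (induction rule: monoid_algebra_induct)
        case (single b d)
        show ?case
          by (simp add: mult_monoid_algebra_single \<open>\<And>w c. \<phi> (Poly_Mapping.single w c) = c *\<^sub>C P w\<close>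
              word_monoid_def P_def scl_expand scl_scl mult.commute[of d c])
      qed (simp_all add: mult_monoid_algebra_add_right add distrib_left zero)
    qed (simp_all add: mult_monoid_algebra_add_left add distrib_right zero)
  qed
  have smult: "\<phi> (Poly_Mapping.map ((*) c) f) = c *\<^sub>C \<phi> f" for c f
    by (subst superset[of "Poly_Mapping.keys f"])
      (auto simp: \<phi>_def in_keys_iff lookup_map_times complex_alg.scale_sum_right scl_scl)
  have "assoc_algebra_hom_axioms free_algebra A (free_lift A g)"
    by unfold_locales
      (simp_all add: lift component_closed assoc_algebra_axioms mult component add smult
        free_algebra_simps single P_def scl_one)
  then show "assoc_algebra_hom free_algebra A (free_lift A g)"
    by (intro assoc_algebra_hom.intro free_algebra assoc_algebra_axioms)
  show "free_lift A g (free_gen s) = g s"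
    by (simp add: lift free_gen_def single P_def scl_one component_embed g)
qed

end

section \<open>Tensor products\<close>

locale algebra_pair = A: assoc_algebra A + B: assoc_algebra B
  for A :: "(complex, 'a) module" and B :: "(complex, 'b) module"
begin

abbreviation pair_algebra where "pair_algebra \<equiv> monoid_algebra (A \<times>\<times> B)"

sublocale M: assoc_algebra pair_algebra
  by (intro monoid_algebra DirProd_monoid A.is_monoid B.is_monoid)

lemma single_carrier: "a \<in> carrier A \<Longrightarrow> b \<in> carrier B \<Longrightarrow> Poly_Mapping.single (a, b) c \<in> carrier pair_algebra"
  by (simp add: carrier_monoid_algebra)

lemma bilinearity_carrier: "bilinearity A B \<subseteq> carrier pair_algebra \<times> carrier pair_algebra"
proof -
  have "f + g \<in> carrier pair_algebra" if "f \<in> carrier pair_algebra" "g \<in> carrier pair_algebra" for f g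
    using M.a_closed[OF that] by (simp add: monoid_algebra_simps)
  then show ?thesis
    by (auto simp: bilinearity_def single_carrier)
qed

sublocale T: algebra_ideal pair_algebra "tensor_ideal A B"
  unfolding tensor_ideal_def by (rule M.relation_ideal(1)[OF bilinearity_carrier])

lemma tensor_algebra: "assoc_algebra (tensor_algebra A B)"
  unfolding tensor_algebra_def by (rule T.assoc_algebra_Q)

abbreviation ten where "ten \<equiv> pure_tensor A B"

lemma pure_tensor_closed: "a \<in> carrier A \<Longrightarrow> b \<in> carrier B \<Longrightarrow> ten a b \<in> carrier (tensor_algebra A B)"
  unfolding tensor_algebra_def pure_tensor_def by (intro T.Q_I single_carrier)

lemma bilinearity_coset:
  "(f, g) \<in> bilinearity A B \<Longrightarrow> tensor_ideal A B +>\<^bsub>pair_algebra\<^esub> f = tensor_ideal A B +>\<^bsub>pair_algebra\<^esub> g"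
  unfolding tensor_ideal_def by (rule M.relation_ideal(2)[OF bilinearity_carrier])

lemma pure_tensor_add_left:
  assumes "a \<in> carrier A" "a' \<in> carrier A" "b \<in> carrier B"
  shows "ten (a \<oplus>\<^bsub>A\<^esub> a') b = ten a b \<oplus>\<^bsub>tensor_algebra A B\<^esub> ten a' b"
proof -
  have "ten (a \<oplus>\<^bsub>A\<^esub> a') b = tensor_ideal A B +>\<^bsub>pair_algebra\<^esub> (Poly_Mapping.single (a, b) 1 \<oplus>\<^bsub>pair_algebra\<^esub> Poly_Mapping.single (a', b) 1)"
    unfolding pure_tensor_def monoid_algebra_simps
    using assms by (intro bilinearity_coset) (auto simp: bilinearity_def)
  then show ?thesis
    using assms by (simp add: pure_tensor_def tensor_algebra_def T.Q_add single_carrier)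
qed

lemma pure_tensor_add_right:
  assumes "a \<in> carrier A" "b \<in> carrier B" "b' \<in> carrier B"
  shows "ten a (b \<oplus>\<^bsub>B\<^esub> b') = ten a b \<oplus>\<^bsub>tensor_algebra A B\<^esub> ten a b'"
proof -
  have "ten a (b \<oplus>\<^bsub>B\<^esub> b') = tensor_ideal A B +>\<^bsub>pair_algebra\<^esub> (Poly_Mapping.single (a, b) 1 \<oplus>\<^bsub>pair_algebra\<^esub> Poly_Mapping.single (a, b') 1)"
    unfolding pure_tensor_def monoid_algebra_simps
    using assms by (intro bilinearity_coset) (auto simp: bilinearity_def)
  then show ?thesis
    using assms by (simp add: pure_tensor_def tensor_algebra_def T.Q_add single_carrier)
qed

lemma smult_single: "c \<odot>\<^bsub>pair_algebra\<^esub> Poly_Mapping.single p 1 = Poly_Mapping.single p c"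
  unfolding monoid_algebra_simps
  by (rule poly_mapping_eqI) (simp add: lookup_map_times lookup_single when_def)

lemma pure_tensor_smult_left:
  assumes "a \<in> carrier A" "b \<in> carrier B"
  shows "ten (c \<odot>\<^bsub>A\<^esub> a) b = c \<odot>\<^bsub>tensor_algebra A B\<^esub> ten a b"
proof -
  have "ten (c \<odot>\<^bsub>A\<^esub> a) b = tensor_ideal A B +>\<^bsub>pair_algebra\<^esub> (c \<odot>\<^bsub>pair_algebra\<^esub> Poly_Mapping.single (a, b) 1)"
    unfolding pure_tensor_def smult_single
    using assms by (intro bilinearity_coset) (auto simp: bilinearity_def)
  then show ?thesis
    using assms by (simp only: pure_tensor_def tensor_algebra_def T.Q_smult single_carrier)
qed

lemma pure_tensor_smult_right:
  assumes "a \<in> carrier A" "b \<in> carrier B"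
  shows "ten a (c \<odot>\<^bsub>B\<^esub> b) = c \<odot>\<^bsub>tensor_algebra A B\<^esub> ten a b"
proof -
  have "ten a (c \<odot>\<^bsub>B\<^esub> b) = tensor_ideal A B +>\<^bsub>pair_algebra\<^esub> (c \<odot>\<^bsub>pair_algebra\<^esub> Poly_Mapping.single (a, b) 1)"
    unfolding pure_tensor_def smult_single
    using assms by (intro bilinearity_coset) (auto simp: bilinearity_def)
  then show ?thesis
    using assms by (simp only: pure_tensor_def tensor_algebra_def T.Q_smult single_carrier)
qed

lemma pure_tensor_mult:
  assumes "a \<in> carrier A" "b \<in> carrier B" "a' \<in> carrier A" "b' \<in> carrier B"
  shows "ten a b \<otimes>\<^bsub>tensor_algebra A B\<^esub> ten a' b' = ten (a \<otimes>\<^bsub>A\<^esub> a') (b \<otimes>\<^bsub>B\<^esub> b')"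
  using assms
  by (simp add: pure_tensor_def tensor_algebra_def T.Q_mult single_carrier mult_monoid_algebra_single)

lemma pure_tensor_one: "ten \<one>\<^bsub>A\<^esub> \<one>\<^bsub>B\<^esub> = \<one>\<^bsub>tensor_algebra A B\<^esub>"
  by (simp add: pure_tensor_def tensor_algebra_def T.Q_one monoid_algebra_simps)

definition tensor :: "'a family \<Rightarrow> 'b family \<Rightarrow> ('a \<times> 'b \<Rightarrow>\<^sub>0 complex) set family" where
  "tensor f g = embed (tensor_algebra A B) (ten (component A f) (component B g))"

sublocale TA: assoc_algebra "tensor_algebra A B"
  by (rule tensor_algebra)

lemma component_in [simp]: "component A f \<in> carrier A" "component B g \<in> carrier B"
  by (simp_all add: component_closed A.assoc_algebra_axioms B.assoc_algebra_axioms)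

lemma tensor_simps:
  "tensor (f + f') g = tensor f g + tensor f' g" "tensor f (g + g') = tensor f g + tensor f g'"
  "tensor (c *\<^sub>C f) g = c *\<^sub>C tensor f g" "tensor f (c *\<^sub>C g) = c *\<^sub>C tensor f g"
  "tensor f g * tensor f' g' = tensor (f * f') (g * g')"
  unfolding tensor_def
  by (simp_all add: A.component B.component pure_tensor_add_left pure_tensor_add_right pure_tensor_smult_left
     pure_tensor_smult_right pure_tensor_closed TA.embed_add TA.embed_smult
     flip: TA.embed_mult pure_tensor_mult)

lemma tensor_embed: "a \<in> carrier A \<Longrightarrow> b \<in> carrier B \<Longrightarrow> tensor (embed A a) (embed B b) = embed (tensor_algebra A B) (ten a b)"
  by (simp add: tensor_def A.component_embed B.component_embed)

end

section \<open>The Jordanian quantum group\<close>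

text \<open>
  Passage from the defining relations to the class: a homomorphism from the free algebra respects
  them exactly when the embedded images of the generators satisfy the relations of
  \<open>jordanian_matrix\<close>, and the image of the additional generator inverts the quantum determinant.
\<close>

lemma hom_gl_relations:
  fixes h :: complex
  assumes "assoc_algebra_hom free_algebra B \<phi>"
  defines "e \<equiv> \<lambda>s. embed B (\<phi> (free_gen s))"
  defines "D \<equiv> e Gen_x * e Gen_y - e Gen_u * e Gen_v - h *\<^sub>C (e Gen_x * e Gen_v)"
  shows "(\<forall>(a, b)\<in>gl_relations h. \<phi> a = \<phi> b) \<longleftrightarrow>
    jordanian_matrix h (e Gen_x) (e Gen_y) (e Gen_u) (e Gen_v) \<and>
    D * e Gen_Dinv = embed B \<one>\<^bsub>B\<^esub> \<and> e Gen_Dinv * D = embed B \<one>\<^bsub>B\<^esub>"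
proof -
  interpret \<phi>: assoc_algebra_hom free_algebra B \<phi> by fact
  have inj: "\<phi> a = \<phi> b \<longleftrightarrow> embed B (\<phi> a) = embed B (\<phi> b)" for a b
    using \<phi>.B.component_embed[OF \<phi>.hom_closed] carrier_free_algebra by metis
  have simps: "embed B (\<phi> (a \<otimes>\<^bsub>free_algebra\<^esub> b)) = embed B (\<phi> a) * embed B (\<phi> b)"
    "embed B (\<phi> (a \<oplus>\<^bsub>free_algebra\<^esub> b)) = embed B (\<phi> a) + embed B (\<phi> b)"
    "embed B (\<phi> (a \<ominus>\<^bsub>free_algebra\<^esub> b)) = embed B (\<phi> a) - embed B (\<phi> b)"
    "embed B (\<phi> (c \<odot>\<^bsub>free_algebra\<^esub> a)) = c *\<^sub>C embed B (\<phi> a)"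
    "embed B (\<phi> (free_gen s)) = e s" for a b c s
    by (simp_all add: \<phi>.hom_mult \<phi>.hom_add \<phi>.hom_minus \<phi>.hom_smult \<phi>.hom_closed e_def
        \<phi>.B.embed_mult \<phi>.B.embed_add \<phi>.B.embed_minus \<phi>.B.embed_smult)
  show ?thesis
    by (simp add: gl_relations_def Let_def inj commutator_def qdet_def simps \<phi>.hom_one
        jordanian_matrix_def D_def)
qed

locale jordanian_group =
  fixes h :: complex
begin

sublocale F: assoc_algebra "free_algebra :: (complex, gl_gen list \<Rightarrow>\<^sub>0 complex) module"
  by (rule free_algebra)

lemma gl_relations_carrier: "gl_relations h \<subseteq> carrier free_algebra \<times> carrier free_algebra"
  by auto

sublocale I: algebra_ideal "free_algebra" "gl_ideal h"
  unfolding gl_ideal_def by (rule F.relation_ideal(1)[OF gl_relations_carrier])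

sublocale GL: assoc_algebra "GL h"
  unfolding GL_def by (rule I.assoc_algebra_Q)

sublocale algebra_pair "GL h" "GL h" ..

abbreviation gen :: "gl_gen \<Rightarrow> gl_elem family" where
  "gen s \<equiv> embed (GL h) (gl_gen_elem h s)"

abbreviation "x \<equiv> gen Gen_x"
abbreviation "y \<equiv> gen Gen_y"
abbreviation "u \<equiv> gen Gen_u"
abbreviation "v \<equiv> gen Gen_v"
abbreviation "t \<equiv> gen Gen_Dinv"
abbreviation "D \<equiv> x * y - u * v - h *\<^sub>C (x * v)"

lemma gen_closed: "gl_gen_elem h s \<in> carrier (GL h)"
  unfolding gl_gen_elem_def GL_def by (rule I.Q_I) simp

lemma component_gen: "component (GL h) (gen s) = gl_gen_elem h s"
  by (rule GL.component_embed[OF gen_closed])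

lemma gen_relations:
  "jordanian_matrix h x y u v" "D * t = embed (GL h) \<one>\<^bsub>GL h\<^esub>" "t * D = embed (GL h) \<one>\<^bsub>GL h\<^esub>"
proof -
  have "\<forall>(a, b)\<in>gl_relations h. gl_ideal h +>\<^bsub>free_algebra\<^esub> a = gl_ideal h +>\<^bsub>free_algebra\<^esub> b"
    unfolding gl_ideal_def using F.relation_ideal(2)[OF gl_relations_carrier] by blast
  then show "jordanian_matrix h x y u v" "D * t = embed (GL h) \<one>\<^bsub>GL h\<^esub>" "t * D = embed (GL h) \<one>\<^bsub>GL h\<^esub>"
    unfolding hom_gl_relations[OF I.proj_hom] GL_def[symmetric] gl_gen_elem_def[symmetric] by blast+
qed

sublocale jordanian_matrix h x y u v
  by (rule gen_relations)

text \<open>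
  The universal property of the quantum group, in a form in which the relations are checked in the
  type class. It is applied to the coproduct and to the counit.
\<close>

lemma gl_lift:
  fixes B :: "(complex, 'b) module"
  assumes B: "assoc_algebra B" and g: "\<And>s. g s \<in> carrier B"
    and jordanian: "jordanian_matrix h (embed B (g Gen_x)) (embed B (g Gen_y)) (embed B (g Gen_u)) (embed B (g Gen_v))"
    and det: "(embed B (g Gen_x) * embed B (g Gen_y) - embed B (g Gen_u) * embed B (g Gen_v)
        - h *\<^sub>C (embed B (g Gen_x) * embed B (g Gen_v))) * embed B (g Gen_Dinv) = embed B \<one>\<^bsub>B\<^esub>"
     "embed B (g Gen_Dinv) * (embed B (g Gen_x) * embed B (g Gen_y) - embed B (g Gen_u) * embed B (g Gen_v)
        - h *\<^sub>C (embed B (g Gen_x) * embed B (g Gen_v))) = embed B \<one>\<^bsub>B\<^esub>"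
  shows "assoc_algebra_hom (GL h) B (quotient_lift (free_lift B g))"
    and "quotient_lift (free_lift B g) (gl_gen_elem h s) = g s"
proof -
  interpret B: assoc_algebra B by fact
  note hom = B.free_lift_hom(1)[OF g] and gen = B.free_lift_hom(2)[OF g]
  have "\<forall>(a, b)\<in>gl_relations h. free_lift B g a = free_lift B g b"
    unfolding hom_gl_relations[OF hom] gen using jordanian det by blast
  then have "free_lift B g i = \<zero>\<^bsub>B\<^esub>" if "i \<in> gl_ideal h" for i
    using that unfolding gl_ideal_def
    by (intro assoc_algebra_hom.hom_relation_ideal[OF hom gl_relations_carrier]) auto
  note lift = I.quotient_lift_hom[OF hom this]
  show "assoc_algebra_hom (GL h) B (quotient_lift (free_lift B g))"
    unfolding GL_def by (rule lift(1))
  show "quotient_lift (free_lift B g) (gl_gen_elem h s) = g s"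
    unfolding gl_gen_elem_def using lift(2)[of "free_gen s"] gen by simp
qed

sublocale tensor_pair h x y u v tensor
  by unfold_locales (rule tensor_simps)+

lemma comult_gen_closed: "comult_gen h s \<in> carrier (GL2 h)"
  by (cases s) (simp_all add: pure_tensor_closed gen_closed)

lemma embed_comult_gen:
  "embed (GL2 h) (comult_gen h Gen_x) = tensor x x + tensor u v"
  "embed (GL2 h) (comult_gen h Gen_y) = tensor v u + tensor y y"
  "embed (GL2 h) (comult_gen h Gen_u) = tensor x u + tensor u y"
  "embed (GL2 h) (comult_gen h Gen_v) = tensor v x + tensor y v"
  "embed (GL2 h) (comult_gen h Gen_Dinv) = tensor t t"
  by (simp_all add: tensor_embed gen_closed pure_tensor_closed TA.embed_add)

lemma tensor_one: "tensor (embed (GL h) \<one>\<^bsub>GL h\<^esub>) (embed (GL h) \<one>\<^bsub>GL h\<^esub>) = embed (GL2 h) \<one>\<^bsub>GL2 h\<^esub>"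
  by (simp add: tensor_embed pure_tensor_one)

lemma comult_hom: "assoc_algebra_hom (GL h) (GL2 h) (comult h)"
  and comult_gl_gen_elem: "comult h (gl_gen_elem h s) = comult_gen h s"
proof -
  note * = gl_lift[OF tensor_algebra, of "comult_gen h", OF comult_gen_closed, unfolded embed_comult_gen,
      OF prod_jordanian, unfolded det tensor_simps gen_relations tensor_one, OF refl refl]
  show "assoc_algebra_hom (GL h) (GL2 h) (comult h)" "comult h (gl_gen_elem h s) = comult_gen h s"
    unfolding comult_def using * by blast+
qed

end

lemma (in assoc_algebra) embed_complex_one: "embed A \<one> * embed A \<one> = embed A \<one>"
  by (simp flip: embed_mult)

lemma counit_hom: "assoc_algebra_hom (GL h) complex_algebra counit"
  and counit_gl_gen_elem: "counit (gl_gen_elem h s) = counit_gen s"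
proof -
  interpret C: assoc_algebra complex_algebra by (rule complex_algebra)
  interpret jordanian_group h .
  have simps: "1 = \<one>\<^bsub>complex_algebra\<^esub>" "0 = \<zero>\<^bsub>complex_algebra\<^esub>" "embed complex_algebra \<zero>\<^bsub>complex_algebra\<^esub> = 0"
    using C.embed_smult[of "\<one>\<^bsub>complex_algebra\<^esub>" 0] by (simp_all add: complex_algebra_def)
  have closed: "counit_gen s \<in> carrier complex_algebra" for s
    by (simp add: complex_algebra_def)
  have "jordanian_matrix h (embed complex_algebra (counit_gen Gen_x)) (embed complex_algebra (counit_gen Gen_y))
     (embed complex_algebra (counit_gen Gen_u)) (embed complex_algebra (counit_gen Gen_v))"
    by unfold_locales (simp_all add: simps C.embed_complex_one)
  note * = gl_lift[OF complex_algebra closed this]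
  show "assoc_algebra_hom (GL h) complex_algebra counit" "counit (gl_gen_elem h s) = counit_gen s"
    unfolding counit_def by (rule *; simp add: simps C.embed_complex_one)+
qed

context jordanian_group
begin

text \<open>
  The coproduct on families: it depends only on the component at \<open>GL h\<close>, and its values live only in the
  component at \<open>GL2 h\<close>.
\<close>

definition \<Delta> :: "gl_elem family \<Rightarrow> _" where
  "\<Delta> f = embed (GL2 h) (comult h (component (GL h) f))"

definition \<epsilon> :: "gl_elem family \<Rightarrow> complex" where
  "\<epsilon> f = counit (component (GL h) f)"

sublocale comultiplication: jordanian_comultiplication h tensor x y u v \<Delta>
proof
  interpret hom: assoc_algebra_hom "GL h" "GL2 h" "comult h" by (rule comult_hom)
  fix f g :: "gl_elem family" and c
  show "\<Delta> (f + g) = \<Delta> f + \<Delta> g" "\<Delta> (c *\<^sub>C f) = c *\<^sub>C \<Delta> f" "\<Delta> (f * g) = \<Delta> f * \<Delta> g"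
    by (simp_all add: \<Delta>_def GL.component hom.hom_add hom.hom_smult hom.hom_mult hom.hom_closed
        TA.embed_add TA.embed_smult TA.embed_mult)
  show "\<Delta> 1 = tensor 1 1"
    by (simp add: \<Delta>_def tensor_def GL.component hom.hom_one pure_tensor_one)
  show "\<Delta> x = tensor x x + tensor u v" "\<Delta> y = tensor v u + tensor y y"
    "\<Delta> u = tensor x u + tensor u y" "\<Delta> v = tensor v x + tensor y v"
    unfolding \<Delta>_def component_gen comult_gl_gen_elem by (rule embed_comult_gen)+
qed

sublocale counit: jordanian_counit h x y u v \<epsilon>
proof
  interpret hom: assoc_algebra_hom "GL h" complex_algebra counit by (rule counit_hom)
  fix f g :: "gl_elem family" and c
  show "\<epsilon> (f + g) = \<epsilon> f + \<epsilon> g" "\<epsilon> (c *\<^sub>C f) = c * \<epsilon> f" "\<epsilon> (f * g) = \<epsilon> f * \<epsilon> g" "\<epsilon> 1 = 1"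
    by (simp_all add: \<epsilon>_def GL.component hom.hom_add hom.hom_smult hom.hom_mult hom.hom_one)
      (simp_all add: complex_algebra_def)
  show "\<epsilon> x = 1" "\<epsilon> y = 1" "\<epsilon> u = 0" "\<epsilon> v = 0"
    by (simp_all add: \<epsilon>_def component_gen counit_gl_gen_elem)
qed

text \<open>
  The factors \<open>W\<close> of the first form are those of \<open>U1\<close> by the factorisation of a difference of squares.
\<close>

lemma component_term1:
  "component (GL h) (term1 K L M N) =
    X1 h K \<otimes>\<^bsub>GL h\<^esub> gl_v h [^]\<^bsub>GL h\<^esub> L \<otimes>\<^bsub>GL h\<^esub> U1 h K L M \<otimes>\<^bsub>GL h\<^esub> Y1 h K L M N"
proof -
  have "h * (of_nat K - of_nat L + of_nat i) * (h * (of_nat K + of_nat L - of_nat i))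
    = h^2 * (of_nat K ^ 2 - (of_nat L - of_nat i) ^ 2)" for i
    by (simp add: power2_eq_square algebra_simps)
  then show ?thesis
    by (simp add: term1_def X1_def U1_def Y1_def GL.component GL.component_oprod GL.component_power component_gen
        X_def W_def Y_def)
qed

lemma component_term2:
  "component (GL h) (term2 K L M N) =
    U2 h M \<otimes>\<^bsub>GL h\<^esub> X2 h K M \<otimes>\<^bsub>GL h\<^esub> Y2 h K M N \<otimes>\<^bsub>GL h\<^esub> gl_v h [^]\<^bsub>GL h\<^esub> L"
proof -
  have W: "W (h * of_nat i) (- (h * of_nat i)) = u + (h * of_nat i) *\<^sub>C (x + y) + (h^2 * of_nat i ^ 2) *\<^sub>C v" for i
    by (simp add: W_def power2_eq_square algebra_simps)
  show ?thesis
    by (simp add: term2_def X2_def U2_def Y2_def GL.component GL.component_oprod GL.component_power component_gen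
        X_def W Y_def)
qed

end

section \<open>From weights to row and column indices\<close>

lemma weights_nat:
  assumes "2 * j \<in> \<nat>" "m \<in> weights j"
  obtains n b where "2 * j = real n" "j + m = real b" "b \<le> n" "j - m = real (n - b)"
proof -
  from assms obtain n b c where *: "2 * j = real n" "j + m = real b" "j - m = real c"
    by (auto simp: weights_def Nats_def)
  then have "n = b + c" by linarith
  with * show ?thesis by (intro that[of n b]) simp_all
qed

lemma bij_betw_weights:
  assumes "2 * j = real n"
  shows "bij_betw (\<lambda>k. real k - j) {..n} (weights j)"
proof (rule bij_betwI[where g = "\<lambda>k. nat \<lfloor>j + k\<rfloor>"])
  show "(\<lambda>k. real k - j) \<in> {..n} \<rightarrow> weights j"
  proof
    fix k assume "k \<in> {..n}"
    then have "j - (real k - j) = real (n - k)" using assms by (simp add: of_nat_diff)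
    then show "real k - j \<in> weights j" by (simp add: weights_def)
  qed
  show "(\<lambda>k. nat \<lfloor>j + k\<rfloor>) \<in> weights j \<rightarrow> {..n}"
  proof
    fix m assume "m \<in> weights j"
    then obtain b c where "j + m = real b" "j - m = real c" by (auto simp: weights_def Nats_def)
    with assms show "nat \<lfloor>j + m\<rfloor> \<in> {..n}" by simp
  qed
next
  fix m assume "m \<in> weights j"
  then obtain b where "j + m = real b" by (auto simp: weights_def Nats_def)
  then show "real (nat \<lfloor>j + m\<rfloor>) - j = m" by simp
qed simp

lemma summation_range_exponents:
  assumes "2 * j = real n" "j + m' = real a" "j + m = real b"
  shows "summation_range j m' m = exponents n a (int b)"
proof -
  have "j - m = real n - real b" "j - m' = real n - real a" using assms by auto
  with assms show ?thesis
    by (auto simp: summation_range_def exponents_def)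
qed

lemma prefactor_nat:
  assumes "2 * j = real n" "j + m' = real a" "j + m = real b" "a \<le> n" "b \<le> n"
  shows "prefactor j m' m = complex_of_real (sqrt (fact a * fact (n - a) * (fact b * fact (n - b))))"
proof -
  have "j - m' = real (n - a)" "j - m = real (n - b)" using assms by auto
  then have "nat \<lfloor>j + m'\<rfloor> = a" "nat \<lfloor>j + m\<rfloor> = b" "nat \<lfloor>j - m'\<rfloor> = n - a" "nat \<lfloor>j - m\<rfloor> = n - b"
    by (simp_all only: assms(2,3) floor_of_nat nat_int)
  then show ?thesis by (simp only: prefactor_def mult.assoc)
qed

lemma prefactor_mult:
  "complex_of_real (sqrt (p * q)) * complex_of_real (sqrt (q * r)) = complex_of_real q * complex_of_real (sqrt (p * r))"
  if "q \<ge> 0"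
proof -
  have "sqrt (p * q) * sqrt (q * r) = q * sqrt (p * r)"
    using that by (simp add: real_sqrt_mult mult_ac)
  then show ?thesis by (metis of_real_mult)
qed

context jordanian_group
begin

lemma D_fun1_matrix_elem:
  assumes "2 * j = real n" "j + m' = real a" "j + m = real b"
  shows "D_fun1 h j m' m = component (GL h) (prefactor j m' m *\<^sub>C matrix_elem n a (int b))"
  unfolding D_fun1_def matrix_elem_def summation_range_exponents[OF assms]
  by (simp add: GL.component GL.component_sum finite_exponents case_prod_unfold component_term1 exp_weight_def)

lemma D_fun2_matrix_elem:
  assumes "2 * j = real n" "j + m' = real a" "j + m = real b"
  shows "D_fun2 h j m' m = component (GL h) (prefactor j m' m *\<^sub>C matrix_elem n a (int b))"
  unfolding D_fun2_def matrix_elem_def summation_range_exponents[OF assms] term1_eq_term2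
  by (simp add: GL.component GL.component_sum finite_exponents case_prod_unfold component_term2 exp_weight_def)

end

theorem proposition5p3:
  fixes h :: complex and j m' m :: real
  assumes "2 * j \<in> \<nat>"
    and "m' \<in> weights j" and "m \<in> weights j"
  shows "D_fun1 h j m' m = D_fun2 h j m' m
    \<and> comult h (D_fun1 h j m' m) =
        (\<Oplus>\<^bsub>GL2 h\<^esub>k\<in>weights j. gl_tensor h (D_fun1 h j m' k) (D_fun1 h j k m))
    \<and> counit (D_fun1 h j m' m) = (if m' = m then 1 else 0)"
proof -
  interpret jordanian_group h .
  obtain n a where n: "2 * j = real n" and a: "j + m' = real a" "a \<le> n"
    using weights_nat[OF assms(1,2)] by blast
  obtain b where b: "j + m = real b" "b \<le> n"
    using weights_nat[OF assms(1,3)] n by (metis of_nat_eq_iff)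
  let ?D = "\<lambda>m' m a b. prefactor j m' m *\<^sub>C matrix_elem n a (int b)"
  let ?c = "\<lambda>k. fact k * fact (n - k) :: real"
  note D = D_fun1_matrix_elem[OF n]
  have pre: "prefactor j p q = complex_of_real (sqrt (?c k * ?c l))"
    if "j + p = real k" "j + q = real l" "k \<le> n" "l \<le> n" for p q k l
    using prefactor_nat[OF n that(1,2,3,4)] .
  have formulas: "D_fun1 h j m' m = D_fun2 h j m' m"
    using D_fun1_matrix_elem[OF n a(1) b(1)] D_fun2_matrix_elem[OF n a(1) b(1)] by simp
  have "comult h (D_fun1 h j m' m) = component (GL2 h) (\<Delta> (?D m' m a b))"
    unfolding D[OF a(1) b(1)] \<Delta>_def
    by (simp add: TA.component_embed assoc_algebra_hom.hom_closed[OF comult_hom])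
  also have "\<Delta> (?D m' m a b) = (\<Sum>k\<le>n. tensor (?D m' (real k - j) a k) (?D (real k - j) m k b))"
    unfolding comultiplication.\<Delta>_scl comultiplication.comult_matrix_elem[OF a(2)] complex_alg.scale_sum_right
  proof (rule sum.cong[OF refl])
    fix k assume "k \<in> {..n}"
    then have k: "k \<le> n" "j + (real k - j) = real k" by simp_all
    have "prefactor j m' m * complex_of_real (?c k) = prefactor j m' (real k - j) * prefactor j (real k - j) m"
      unfolding pre[OF a(1) b(1) a(2) b(2)] pre[OF a(1) k(2) a(2) k(1)] pre[OF k(2) b(1) k(1) b(2)]
      by (subst prefactor_mult) (simp_all only: mult.commute mult_nonneg_nonneg fact_ge_zero)
    then show "prefactor j m' m *\<^sub>C (fact k * fact (n - k)) *\<^sub>C tensor (matrix_elem n a (int k)) (matrix_elem n k (int b))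
      = tensor (?D m' (real k - j) a k) (?D (real k - j) m k b)"
      by (simp add: tensor_simps scl_scl mult.commute[of "prefactor j (real k - j) m"])
  qed
  also have "component (GL2 h) \<dots> = component (GL2 h) (\<Sum>k\<le>n. embed (GL2 h) (gl_tensor h (D_fun1 h j m' (real k - j)) (D_fun1 h j (real k - j) m)))"
    using a b by (simp add: D tensor_def)
  also have "\<dots> = component (GL2 h) (\<Sum>k\<in>weights j. embed (GL2 h) (gl_tensor h (D_fun1 h j m' k) (D_fun1 h j k m)))"
    by (rule arg_cong[where f = "component (GL2 h)", OF sum.reindex_bij_betw[OF bij_betw_weights[OF n]]])
  also have "\<dots> = (\<Oplus>\<^bsub>GL2 h\<^esub>k\<in>weights j. gl_tensor h (D_fun1 h j m' k) (D_fun1 h j k m))"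
  proof -
    have closed: "D_fun1 h j p q \<in> carrier (GL h)" if "p \<in> weights j" "q \<in> weights j" for p q
      using that D by (auto simp: weights_def Nats_def)
    have "finite (weights j)" using bij_betw_finite[OF bij_betw_weights[OF n]] by simp
    then show ?thesis
      using assms by (simp add: TA.component_sum)
        (intro TA.finsum_cong', auto simp: TA.component_embed pure_tensor_closed closed)
  qed
  finally have coproduct: "comult h (D_fun1 h j m' m) =
        (\<Oplus>\<^bsub>GL2 h\<^esub>k\<in>weights j. gl_tensor h (D_fun1 h j m' k) (D_fun1 h j k m))" .
  have "counit (D_fun1 h j m' m) = (if m' = m then 1 else 0)"
  proof -
    have "counit (D_fun1 h j m' m) = prefactor j m' m * \<epsilon> (matrix_elem n a (int b))"
      unfolding D[OF a(1) b(1)] by (simp add: \<epsilon>_def[symmetric] counit.\<epsilon>_scl)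
    also have "\<dots> = (if a = b then 1 else 0)"
      using a b by (simp add: counit.counit_matrix_elem pre)
    also have "a = b \<longleftrightarrow> m' = m" using a b by auto
    finally show ?thesis .
  qed
  with formulas coproduct show ?thesis by blast
qed

end
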